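(* Let $k\ge 4$ be an integer. For $X\ge 2$ and $D\ge 1$, $$\sum_{d\le D}\ \sum_{\substack{a=1\\ (a,d)=1}}^{d}\Delta(\tau_k;X,d,a)^2\ll\left(D+X^{1-\frac{1}{6(k+2)}}\right)X(\log X)^{k^2-1},$$ where the implied constant depends at most on $k$.
   Context: $\tau_k(n)$ is the $k$-fold divisor function (number of ordered factorizations $n=n_1\cdots n_k$ into positive integers). For $(a,d)=1$, $$\Delta(\tau_k;X,d,a)=\sum_{\substack{n\le X\\ n\equiv a\ (\mathrm{mod}\ d)}}\tau_k(n)-\frac{1}{\varphi(d)}\sum_{\substack{n\le X\\ (n,d)=1}}\tau_k(n),$$ with $\varphi$ Euler's totient function. *)

theory Defs
  imports Complex_Main "HOL-Number_Theory.Number_Theory"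
begin

definition tau :: "nat \<Rightarrow> nat \<Rightarrow> nat" where
  "tau k n = card {ms :: nat list. length ms = k \<and> (\<forall>m\<in>set ms. 0 < m) \<and> prod_list ms = n}"

definition Delta :: "(nat \<Rightarrow> real) \<Rightarrow> real \<Rightarrow> nat \<Rightarrow> nat \<Rightarrow> real" where
  "Delta f X d a =
     (\<Sum>n | 0 < n \<and> real n \<le> X \<and> [n = a] (mod d). f n)
     - 1 / real (totient d) * (\<Sum>n | 0 < n \<and> real n \<le> X \<and> coprime n d. f n)"

end

theory Submission
  imports Defs "HOL-Analysis.Analysis"
begin

text \<open>
  Write \<open>S(x)\<close> for the exponential sum of \<open>\<tau>\<^sub>k\<close> up to \<open>X\<close> and expand the sum of \<open>\<tau>\<^sub>k\<close> over a residue class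
  modulo \<open>d\<close> into the frequencies \<open>b/d\<close>. Split these by the denominator \<open>q\<close> of \<open>b/d\<close> in lowest terms,
  at \<open>K = X^(1/(6k))\<close>. Since the mean over the units minimises the variance, it may be replaced by the
  contribution of the small denominators at the class of 1.

  For \<open>q > K\<close>, Parseval and the additive large sieve for Farey fractions apply. No coprimality condition
  enters, so no Dirichlet characters are needed, and summation by parts over \<open>q\<close> gives the term \<open>D X\<close>
  without a further logarithm. The mean square of \<open>\<tau>\<^sub>k\<close> is bounded through \<open>\<tau>\<^sub>k\<^sup>2 \<le> \<tau>\<close> with index \<open>k\<^sup>2\<close>.

  For \<open>q \<le> K\<close>, the contribution at a unit \<open>u\<close> differs from that at 1 only through \<open>S(ub/q) - S(b/q)\<close>. The
  hyperbola method bounds this by \<open>q X^(1-1/k)\<close> up to logarithms, because a \<open>q\<close>-periodic function and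
  its dilation by \<open>u\<close> have the same sum over a period.
\<close>

section \<open>Divisor functions\<close>

definition factorizations :: "nat \<Rightarrow> nat \<Rightarrow> nat list set" where
  "factorizations k n = {ms. length ms = k \<and> (\<forall>m\<in>set ms. 0 < m) \<and> prod_list ms = n}"

lemma tau_eq: "tau k n = card (factorizations k n)"
  by (simp add: tau_def factorizations_def)

lemma finite_factorizations:
  assumes "n > 0"
  shows "finite (factorizations k n)"
proof (rule finite_subset)
  show "factorizations k n \<subseteq> {ms. set ms \<subseteq> {..n} \<and> length ms = k}"
    using assms by (auto simp: factorizations_def dest: prod_list_dvd dvd_imp_le)
  show "finite {ms. set ms \<subseteq> {..n} \<and> length ms = k}"
    by (rule finite_lists_length_eq) simp
qed

lemma tau_0: "tau 0 n = (if n = 1 then 1 else 0)"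
proof -
  have "factorizations 0 n = (if n = 1 then {[]} else {})"
    by (auto simp: factorizations_def)
  then show ?thesis by (simp add: tau_eq)
qed

lemma tau_1:
  assumes "n > 0"
  shows "tau (Suc 0) n = 1"
proof -
  have "factorizations (Suc 0) n = {[n]}"
    using assms by (auto simp: factorizations_def length_Suc_conv)
  then show ?thesis by (simp add: tau_eq)
qed

text \<open>Cut a list of length k + l after its first k entries. The pieces for different divisors
  a are disjoint because a is recovered as the product of those entries.\<close>

lemma tau_add:
  assumes "n > 0"
  shows "tau (k + l) n = (\<Sum>a | a dvd n. tau k a * tau l (n div a))"
proof -
  let ?P = "\<lambda>a. (\<lambda>(xs, ys). xs @ ys) ` (factorizations k a \<times> factorizations l (n div a))"
  have pos: "a > 0" "n div a > 0" if "a dvd n" for a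
    using that assms by (auto intro!: Nat.gr0I)
  have take: "prod_list (take k ms) = a" if "ms \<in> ?P a" for a ms
    using that by (auto simp: factorizations_def)
  have inj: "inj_on (\<lambda>(xs, ys). xs @ ys) (factorizations k a \<times> factorizations l (n div a))" for a
    by (auto simp: inj_on_def factorizations_def)
  have "factorizations (k + l) n = (\<Union>a\<in>{a. a dvd n}. ?P a)"
  proof (intro equalityI subsetI)
    fix ms assume ms: "ms \<in> factorizations (k + l) n"
    define xs ys where "xs = take k ms" and "ys = drop k ms"
    have app: "ms = xs @ ys" by (simp add: xs_def ys_def)
    have n: "n = prod_list xs * prod_list ys"
      using ms by (simp add: app factorizations_def)
    then have p: "prod_list xs > 0" using assms by (auto intro!: Nat.gr0I)
    have "xs \<in> factorizations k (prod_list xs)" "ys \<in> factorizations l (n div prod_list xs)"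
      using ms p by (auto simp: factorizations_def xs_def ys_def n[unfolded xs_def ys_def]
          dest: in_set_takeD in_set_dropD)
    moreover have "prod_list xs dvd n" using n by simp
    ultimately show "ms \<in> (\<Union>a\<in>{a. a dvd n}. ?P a)" using app by force
  qed (auto simp: factorizations_def)
  then have "tau (k + l) n = card (\<Union>a\<in>{a. a dvd n}. ?P a)"
    by (simp add: tau_eq)
  also have "\<dots> = (\<Sum>a | a dvd n. card (?P a))"
  proof (rule card_UN_disjoint)
    show "finite {a. a dvd n}" using assms by simp
    show "\<forall>a\<in>{a. a dvd n}. finite (?P a)" using pos finite_factorizations by auto
    show "\<forall>a\<in>{a. a dvd n}. \<forall>b\<in>{a. a dvd n}. a \<noteq> b \<longrightarrow> ?P a \<inter> ?P b = {}"
      using take by blast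
  qed
  also have "\<dots> = (\<Sum>a | a dvd n. tau k a * tau l (n div a))"
    by (simp add: card_image[OF inj] card_cartesian_product tau_eq)
  finally show ?thesis .
qed

lemma tau_Suc:
  assumes "n > 0"
  shows "tau (Suc k) n = (\<Sum>a | a dvd n. tau k a)"
proof -
  have "tau (Suc k) n = (\<Sum>a | a dvd n. tau k a * tau (Suc 0) (n div a))"
    using tau_add[OF assms, of k 1] by simp
  also have "\<dots> = (\<Sum>a | a dvd n. tau k a)"
    using assms by (intro sum.cong refl) (auto simp: tau_1 dvd_div_eq_0_iff)
  finally show ?thesis .
qed

text \<open>Every divisor of m n is a product of a divisor of m and one of n. Without coprimality
  this can happen in several ways, so summing over pairs overcounts and only an inequality
  results.\<close>

lemma tau_mult_le:
  assumes "m > 0" "n > 0"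
  shows "tau k (m * n) \<le> tau k m * tau k n"
  using assms
proof (induction k arbitrary: m n)
  case 0
  then show ?case by (auto simp: tau_0)
next
  case (Suc k)
  let ?A = "{a. a dvd m} \<times> {b. b dvd n}"
  have fin: "finite ?A" using Suc.prems by simp
  have "{d. d dvd m * n} = (\<lambda>(a, b). a * b) ` ?A"
  proof (intro equalityI subsetI)
    fix d assume "d \<in> {d. d dvd m * n}"
    then obtain a b where "d = a * b" "a dvd m" "b dvd n"
      using division_decomp[of d m n] by auto
    then show "d \<in> (\<lambda>(a, b). a * b) ` ?A" by blast
  qed (auto intro: mult_dvd_mono)
  then have "tau (Suc k) (m * n) = (\<Sum>d\<in>(\<lambda>(a, b). a * b) ` ?A. tau k d)"
    using Suc.prems by (simp add: tau_Suc)
  also have "\<dots> \<le> (\<Sum>p\<in>?A. tau k (fst p * snd p))"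
    by (rule order_trans[OF sum_image_le[OF fin]]) (auto simp: case_prod_beta)
  also have "\<dots> \<le> (\<Sum>p\<in>?A. tau k (fst p) * tau k (snd p))"
    using Suc.prems by (intro sum_mono Suc.IH) (auto intro!: Nat.gr0I)
  also have "\<dots> = tau (Suc k) m * tau (Suc k) n"
    using Suc.prems by (simp add: tau_Suc sum_product sum.cartesian_product case_prod_beta)
  finally show ?case .
qed

lemma tau_one: "tau k (Suc 0) = Suc 0"
  by (induction k) (auto simp: tau_0 tau_Suc)

text \<open>Each pair of factorizations of n has a common refinement; the induction counts these without
  constructing them.\<close>

lemma tau_times_tau_le:
  assumes "n > 0"
  shows "tau k n * tau l n \<le> tau (k * l) n"
  using assms
proof (induction k arbitrary: n)
  case 0
  then show ?case by (simp add: tau_0 tau_one)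
next
  case (Suc k)
  have "tau (Suc k) n * tau l n = (\<Sum>a | a dvd n. tau k a * tau l (a * (n div a)))"
    using Suc.prems by (simp add: tau_Suc sum_distrib_right)
  also have "\<dots> \<le> (\<Sum>a | a dvd n. tau (k * l) a * tau l (n div a))"
  proof (rule sum_mono)
    fix a assume "a \<in> {a. a dvd n}"
    then have pos: "a > 0" "n div a > 0" using Suc.prems by (auto intro!: Nat.gr0I)
    \<comment> \<open>Submultiplicativity splits off the factor at a, which the induction hypothesis
      then merges with \<open>tau k a\<close>.\<close>
    have "tau k a * tau l (a * (n div a)) \<le> tau k a * tau l a * tau l (n div a)"
      using tau_mult_le[OF pos, of l] by (simp add: mult.assoc)
    also have "\<dots> \<le> tau (k * l) a * tau l (n div a)"
      using Suc.IH[OF pos(1)] by simp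
    finally show "tau k a * tau l (a * (n div a)) \<le> tau (k * l) a * tau l (n div a)" .
  qed
  also have "\<dots> = tau (Suc k * l) n"
    using tau_add[OF Suc.prems, of "k * l" l] by (simp add: add.commute)
  finally show ?case .
qed

section \<open>Sums over pairs with bounded product, and moments of the divisor functions\<close>

lemma sum_divisor_pairs:
  fixes f :: "nat \<Rightarrow> nat \<Rightarrow> 'a::comm_monoid_add"
  shows "(\<Sum>n=1..N. \<Sum>a | a dvd n. f a (n div a)) = (\<Sum>a=1..N. \<Sum>b=1..N div a. f a b)"
proof -
  have "(\<Sum>n=1..N. \<Sum>a | a dvd n. f a (n div a)) = (\<Sum>(n,a)\<in>Sigma {1..N} (\<lambda>n. {a. a dvd n}). f a (n div a))"
    by (subst sum.Sigma) auto
  also have "\<dots> = (\<Sum>(a,b)\<in>Sigma {1..N} (\<lambda>a. {1..N div a}). f a b)"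
    by (rule sum.reindex_bij_witness[of _ "\<lambda>(a,b). (a * b, a)" "\<lambda>(n,a). (a, n div a)"])
      (auto simp: div_le_mono dvd_imp_le Suc_le_eq less_eq_div_iff_mult_less_eq mult.commute
        dvd_div_eq_0_iff intro!: Nat.gr0I intro: order_trans[OF dvd_imp_le])
  also have "\<dots> = (\<Sum>a=1..N. \<Sum>b=1..N div a. f a b)"
    by (subst sum.Sigma) auto
  finally show ?thesis .
qed

text \<open>The new factor b carries weight one. This smooth variable is what the hyperbola method
  exploits.\<close>

lemma sum_tau_Suc:
  fixes h :: "nat \<Rightarrow> 'a::comm_ring_1"
  shows "(\<Sum>n=1..N. of_nat (tau (Suc k) n) * h n)
    = (\<Sum>a=1..N. \<Sum>b=1..N div a. of_nat (tau k a) * h (a * b))"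
proof -
  have "(\<Sum>n=1..N. of_nat (tau (Suc k) n) * h n)
      = (\<Sum>n=1..N. \<Sum>a | a dvd n. of_nat (tau k a) * h (a * (n div a)))"
    by (intro sum.cong) (auto simp: tau_Suc sum_distrib_right)
  also have "\<dots> = (\<Sum>a=1..N. \<Sum>b=1..N div a. of_nat (tau k a) * h (a * b))"
    by (rule sum_divisor_pairs)
  finally show ?thesis .
qed

lemma sum_swap_div:
  fixes f :: "nat \<Rightarrow> nat \<Rightarrow> 'a::comm_monoid_add"
  shows "(\<Sum>a=1..N. \<Sum>b=1..N div a. f a b) = (\<Sum>b=1..N. \<Sum>a=1..N div b. f a b)"
proof -
  have le: "b \<le> N" if "Suc 0 \<le> a" "a * b \<le> N" for a b
    using order_trans[of b "a * b" N] that by simp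
  have "(\<Sum>a=1..N. \<Sum>b=1..N div a. f a b) = (\<Sum>(a,b)\<in>Sigma {1..N} (\<lambda>a. {1..N div a}). f a b)"
    by (subst sum.Sigma) auto
  also have "\<dots> = (\<Sum>(b,a)\<in>Sigma {1..N} (\<lambda>a. {1..N div a}). f a b)"
    by (rule sum.reindex_bij_witness[of _ "\<lambda>(a,b). (b,a)" "\<lambda>(a,b). (b,a)"])
      (auto simp: less_eq_div_iff_mult_less_eq mult.commute intro: le)
  also have "\<dots> = (\<Sum>b=1..N. \<Sum>a=1..N div b. f a b)"
    by (subst sum.Sigma) auto
  finally show ?thesis .
qed

lemma harm_le_ln: "n > 0 \<Longrightarrow> (\<Sum>i=1..n. 1 / real i) \<le> 1 + ln (real n)"
  using decseqD[OF decseq_harm_diff_ln, of 0 "n - 1"] by (simp add: harm_def divide_inverse)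

text \<open>For fixed b the other variable runs up to N/b, so each additional factor costs one
  harmonic sum, that is, one logarithm.\<close>

lemma sum_tau_le:
  shows "(\<Sum>n=1..N. real (tau (Suc m) n)) \<le> real N * (1 + ln (real N)) ^ m"
proof (induction m arbitrary: N)
  case 0
  have "(\<Sum>n=1..N. real (tau (Suc 0) n)) = (\<Sum>n=1..N. 1)"
    by (intro sum.cong) (auto simp: tau_1)
  then show ?case by simp
next
  case (Suc m)
  show ?case
  proof (cases "N = 0")
    case False
    have "(\<Sum>n=1..N. real (tau (Suc (Suc m)) n)) = (\<Sum>b=1..N. \<Sum>a=1..N div b. real (tau (Suc m) a))"
      using sum_tau_Suc[where h = "\<lambda>_. 1 :: real" and N = N and k = "Suc m"]
      by (subst sum_swap_div[symmetric]) simp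
    also have "\<dots> \<le> (\<Sum>b=1..N. real N / real b * (1 + ln (real N)) ^ m)"
    proof (rule sum_mono)
      fix b assume b: "b \<in> {1..N}"
      then have d: "N div b > 0" "N div b \<le> N" by (auto simp: div_greater_zero_iff)
      have "(\<Sum>a=1..N div b. real (tau (Suc m) a)) \<le> real (N div b) * (1 + ln (real (N div b))) ^ m"
        by (rule Suc.IH)
      also have "\<dots> \<le> real N / real b * (1 + ln (real N)) ^ m"
        using d by (intro mult_mono power_mono of_nat_div_le_of_nat add_left_mono ln_mono) auto
      finally show "(\<Sum>a=1..N div b. real (tau (Suc m) a)) \<le> real N / real b * (1 + ln (real N)) ^ m" .
    qed
    also have "\<dots> = real N * (1 + ln (real N)) ^ m * (\<Sum>b=1..N. 1 / real b)"
      by (simp add: sum_distrib_left mult_ac)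
    also have "\<dots> \<le> real N * (1 + ln (real N)) ^ m * (1 + ln (real N))"
      using False by (intro mult_left_mono harm_le_ln) auto
    finally show ?thesis by (simp add: mult_ac)
  qed simp
qed

text \<open>This is the source of the exponent k^2 - 1 of the logarithm in the theorem.\<close>

lemma sum_tau_squared_le:
  assumes "k > 0"
  shows "(\<Sum>n=1..N. (real (tau k n))\<^sup>2) \<le> real N * (1 + ln (real N)) ^ (k\<^sup>2 - 1)"
proof -
  have "(\<Sum>n=1..N. (real (tau k n))\<^sup>2) \<le> (\<Sum>n=1..N. real (tau (k\<^sup>2) n))"
  proof (rule sum_mono)
    fix n assume "n \<in> {1..N}"
    then have "tau k n * tau k n \<le> tau (k * k) n" by (intro tau_times_tau_le) auto
    then show "(real (tau k n))\<^sup>2 \<le> real (tau (k\<^sup>2) n)"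
      unfolding power2_eq_square by (metis of_nat_le_iff of_nat_mult)
  qed
  also have "\<dots> \<le> real N * (1 + ln (real N)) ^ (k\<^sup>2 - 1)"
    using sum_tau_le[of "k\<^sup>2 - 1" N] assms by simp
  finally show ?thesis .
qed

section \<open>Dilations of periodic functions\<close>

lemma periodic_mod:
  fixes g :: "nat \<Rightarrow> 'a"
  assumes "\<And>n. g (n + q) = g n"
  shows "g (n mod q) = g n"
proof -
  have "g (m + j * q) = g m" for m j
    by (induction j) (use assms in \<open>simp_all add: algebra_simps\<close>, metis add.assoc add.commute assms)
  from this[of "n mod q" "n div q"] show ?thesis by simp
qed

text \<open>Multiplication by a unit permutes the residues modulo q; for q = 0 both sums are
  empty.\<close>

lemma periodic_sum_unit_mult:
  fixes g :: "nat \<Rightarrow> 'a::comm_monoid_add"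
  assumes per: "\<And>n. g (n + q) = g n" and "coprime u q"
  shows "(\<Sum>n<q. g (u * n)) = (\<Sum>n<q. g n)"
proof (cases "q = 0")
  case False
  have inj: "inj_on (\<lambda>n. u * n mod q) {..<q}"
  proof (rule inj_onI)
    fix x y assume xy: "x \<in> {..<q}" "y \<in> {..<q}" "u * x mod q = u * y mod q"
    then have "[u * x = u * y] (mod q)" by (simp add: Cong.cong_def)
    then have "[x = y] (mod q)"
      using cong_mult_lcancel_nat[of u q x y] assms(2) by simp
    then show "x = y" using xy by (simp add: Cong.cong_def)
  qed
  have bij: "bij_betw (\<lambda>n. u * n mod q) {..<q} {..<q}"
    unfolding bij_betw_def using inj False by (intro conjI endo_inj_surj) auto
  have "(\<Sum>n<q. g (u * n)) = (\<Sum>n<q. g (u * n mod q))"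
    by (simp add: periodic_mod[of g q, OF per])
  also have "\<dots> = (\<Sum>n<q. g n)"
    using sum.reindex_bij_betw[OF bij, of g] by simp
  finally show ?thesis .
qed simp

text \<open>Complete periods cancel and are stripped off one at a time, leaving at most one
  incomplete period to be bounded trivially.\<close>

lemma norm_sum_periodic_le:
  fixes h :: "nat \<Rightarrow> complex"
  assumes "q > 0" and per: "\<And>n. h (n + q) = h n" and zero: "(\<Sum>n<q. h n) = 0"
    and bd: "\<And>n. norm (h n) \<le> M"
  shows "norm (\<Sum>n<Y. h n) \<le> M * real q"
proof (induction Y rule: less_induct)
  case (less Y)
  have M: "M \<ge> 0" using bd[of 0] norm_ge_zero order_trans by blast
  show ?case
  proof (cases "Y \<le> q")
    case True
    have "norm (\<Sum>n<Y. h n) \<le> (\<Sum>n<Y. M)" by (intro order_trans[OF norm_sum] sum_mono bd)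
    also have "\<dots> \<le> M * real q" using True M by (simp add: mult_left_mono mult.commute)
    finally show ?thesis .
  next
    case False
    have "(\<Sum>n<Y. h n) = (\<Sum>n<q. h n) + (\<Sum>n=q..<q + (Y - q). h n)"
      using False by (simp add: lessThan_atLeast0 sum.atLeastLessThan_concat)
    also have "(\<Sum>n=q..<q + (Y - q). h n) = (\<Sum>n<Y - q. h n)"
      using sum.shift_bounds_nat_ivl[of h 0 q "Y - q"] per by (simp add: lessThan_atLeast0 add.commute)
    finally show ?thesis using less.IH[of "Y - q"] False \<open>q > 0\<close> zero by simp
  qed
qed

lemma norm_sum_dilation_le:
  fixes g :: "nat \<Rightarrow> complex"
  assumes q: "q > 0" and per: "\<And>n. g (n + q) = g n" and bd: "\<And>n. norm (g n) \<le> 1" and cop: "coprime u q"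
  shows "norm (\<Sum>n=1..Y. g (u * n) - g n) \<le> 2 * real q"
proof -
  let ?h = "\<lambda>n. g (u * n) - g n"
  \<comment> \<open>The term n = 0 can be added freely, since \<open>u * 0 = 0\<close> makes it
    vanish.\<close>
  have "(\<Sum>n=1..Y. ?h n) = (\<Sum>n<Suc Y. ?h n)"
    by (subst sum.lessThan_Suc_shift) (simp add: sum.atLeast1_atMost_eq lessThan_Suc_atMost)
  also have "norm \<dots> \<le> 2 * real q"
  proof (rule norm_sum_periodic_le[OF q])
    fix n
    have "g (u * (n + q)) = g (u * n)"
      using periodic_mod[of g q, OF per] by (metis distrib_left mod_mult_self1 mult.commute)
    then show "?h (n + q) = ?h n" using per by simp
    show "norm (?h n) \<le> 2" using norm_triangle_ineq4[of "g (u * n)" "g n"] bd[of "u * n"] bd[of n] by simp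
  qed (simp add: sum_subtractf periodic_sum_unit_mult[of g q, OF per cop])
  finally show ?thesis .
qed

section \<open>The hyperbola method for divisor sums twisted by periodic functions\<close>

lemma sum_hyperbola:
  fixes f :: "nat \<Rightarrow> nat \<Rightarrow> 'a::comm_monoid_add"
  assumes "L \<le> Y"
  shows "(\<Sum>a=1..Y. \<Sum>b=1..Y div a. f a b)
    = (\<Sum>b=1..L. \<Sum>a=1..Y div b. f a b) + (\<Sum>a=1..Y. \<Sum>b=Suc L..Y div a. f a b)"
proof -
  let ?f = "\<lambda>a b. if b \<le> L then 0 else f a b"
  have "(\<Sum>a=1..Y. \<Sum>b=1..Y div a. f a b) = (\<Sum>b=1..Y. \<Sum>a=1..Y div b. f a b)"
    by (rule sum_swap_div)
  also have "\<dots> = (\<Sum>b=1..L. \<Sum>a=1..Y div b. f a b) + (\<Sum>b=L+1..Y. \<Sum>a=1..Y div b. f a b)"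
    using assms sum.ub_add_nat[of 1 L "\<lambda>b. \<Sum>a=1..Y div b. f a b" "Y - L"] by simp
  also have "(\<Sum>b=L+1..Y. \<Sum>a=1..Y div b. f a b) = (\<Sum>b=1..Y. \<Sum>a=1..Y div b. ?f a b)"
    by (rule sum.mono_neutral_cong_left) auto
  also have "\<dots> = (\<Sum>a=1..Y. \<Sum>b=1..Y div a. ?f a b)"
    by (rule sum_swap_div[symmetric])
  also have "\<dots> = (\<Sum>a=1..Y. \<Sum>b=Suc L..Y div a. f a b)"
    by (intro sum.cong refl sum.mono_neutral_cong_right) auto
  finally show ?thesis .
qed

text \<open>Induction on k through the hyperbola method. For small b the hypothesis is applied to
  the function n -> g (b n), for large b the cancellation comes from b itself. The first case is why
  B must be uniform in g, q, u and Y.\<close>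

lemma tau_dilation_bound:
  "\<exists>B\<ge>0. \<forall>q u Y. \<forall>g :: nat \<Rightarrow> complex. q > 0 \<longrightarrow> Y > 0 \<longrightarrow> coprime u q \<longrightarrow> (\<forall>n. g (n + q) = g n) \<longrightarrow>
     (\<forall>n. norm (g n) \<le> 1) \<longrightarrow>
     norm (\<Sum>n=1..Y. of_nat (tau (Suc k) n) * (g (u * n) - g n))
       \<le> B * real q * real Y powr (1 - 1 / real (Suc k)) * (1 + ln (real Y)) ^ k"
proof (induction k)
  case 0
  show ?case
  proof (intro exI[of _ 2] conjI allI impI)
    fix q u Y :: nat and g :: "nat \<Rightarrow> complex"
    assume *: "q > 0" "Y > 0" "coprime u q" "\<forall>n. g (n + q) = g n" "\<forall>n. norm (g n) \<le> 1"
    have "(\<Sum>n=1..Y. of_nat (tau (Suc 0) n) * (g (u * n) - g n)) = (\<Sum>n=1..Y. g (u * n) - g n)"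
      by (intro sum.cong) (auto simp: tau_1)
    then show "norm (\<Sum>n=1..Y. of_nat (tau (Suc 0) n) * (g (u * n) - g n))
       \<le> 2 * real q * real Y powr (1 - 1 / real (Suc 0)) * (1 + ln (real Y)) ^ 0"
      using norm_sum_dilation_le[of q g u Y] * by simp
  qed simp
next
  case (Suc k)
  then obtain B where B: "B \<ge> 0" and IH: "\<And>q u Y (g :: nat \<Rightarrow> complex).
     \<lbrakk>q > 0; Y > 0; coprime u q; \<And>n. g (n + q) = g n; \<And>n. norm (g n) \<le> 1\<rbrakk> \<Longrightarrow>
     norm (\<Sum>n=1..Y. of_nat (tau (Suc k) n) * (g (u * n) - g n))
       \<le> B * real q * real Y powr (1 - 1 / real (Suc k)) * (1 + ln (real Y)) ^ k"
    by blast
  show ?case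
  \<comment> \<open>The small b contribute 2 B and the large b contribute 4.\<close>
  proof (intro exI[of _ "2 * B + 4"] conjI allI impI)
    fix q u Y :: nat and g :: "nat \<Rightarrow> complex"
    assume q: "q > 0" and Y: "Y > 0" and cop: "coprime u q"
      and "\<forall>n. g (n + q) = g n" and "\<forall>n. norm (g n) \<le> 1"
    then have per: "\<And>n. g (n + q) = g n" and bd: "\<And>n. norm (g n) \<le> 1" by auto
    have per_mult: "g (m * (n + q)) = g (m * n)" for m n
      using periodic_mod[of g q, OF per] by (metis distrib_left mod_mult_self1 mult.commute)
    define K where "K = real (Suc (Suc k))"
    define s where "s = 1 - 1 / real (Suc k)"
    \<comment> \<open>This cut balances the two ranges: small b give Y^s L^(1/(k+1)) and large b
      give Y/L, and both have order Y^(1 - 1/(k+2)) up to logarithms.\<close>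
    define L where "L = nat \<lceil>real Y powr (1 / K)\<rceil>"
    define l where "l = 1 + ln (real Y)"
    have l: "l \<ge> 1" using Y by (simp add: l_def)
    have s: "s \<ge> 0" by (simp add: s_def)
    have K: "K \<ge> 2" by (simp add: K_def)
    have Y1: "real Y powr (1 / K) \<ge> 1" using Y K by (intro ge_one_powr_ge_zero) auto
    have "real Y powr (1 / K) \<le> real Y powr 1"
      using Y K by (intro powr_mono) auto
    then have LY: "L \<le> Y" using Y unfolding L_def by (simp add: nat_le_iff ceiling_le_iff)
    have Lge: "real L \<ge> real Y powr (1 / K)" unfolding L_def by linarith
    have Lle: "real L \<le> 2 * real Y powr (1 / K)" using Y1 unfolding L_def by linarith
    have Lpos: "L > 0" using Lge Y1 by (simp add: Nat.gr0I)
    let ?f = "\<lambda>a b. of_nat (tau (Suc k) a) * (g (u * (a * b)) - g (a * b))"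
    have split: "(\<Sum>n=1..Y. of_nat (tau (Suc (Suc k)) n) * (g (u * n) - g n))
      = (\<Sum>b=1..L. \<Sum>a=1..Y div b. ?f a b) + (\<Sum>a=1..Y. \<Sum>b=Suc L..Y div a. ?f a b)"
      using sum_tau_Suc[where h = "\<lambda>n. g (u * n) - g n" and N = Y and k = "Suc k"]
        sum_hyperbola[OF LY, of ?f] by simp
    have "norm (\<Sum>b=1..L. \<Sum>a=1..Y div b. ?f a b)
      \<le> (\<Sum>b=1..L. (B * real q * real Y powr s * real L powr (1 / real (Suc k)) * l ^ k) * (1 / real b))"
    proof (rule order_trans[OF norm_sum], rule sum_mono)
      fix b assume b: "b \<in> {1..L}"
      then have d: "Y div b > 0" "Y div b \<le> Y" using LY by (auto simp: div_greater_zero_iff)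
      have "norm (\<Sum>a=1..Y div b. ?f a b)
         = norm (\<Sum>a=1..Y div b. of_nat (tau (Suc k) a) * (g (b * (u * a)) - g (b * a)))"
        by (simp add: mult_ac)
      \<comment> \<open>The dilate n -> g (b n) again has period q and norm at most 1, so the
        induction hypothesis applies to it.\<close>
      also have "\<dots> \<le> B * real q * real (Y div b) powr s * (1 + ln (real (Y div b))) ^ k"
        unfolding s_def using d q cop by (intro IH[of q _ u "\<lambda>n. g (b * n)"]) (auto simp: per_mult bd)
      also have "\<dots> \<le> B * real q * (real Y / real b) powr s * l ^ k"
        unfolding l_def using d B s
        by (intro mult_mono power_mono powr_mono2 of_nat_div_le_of_nat add_left_mono ln_mono) auto
      finally have *: "norm (\<Sum>a=1..Y div b. ?f a b) \<le> B * real q * (real Y / real b) powr s * l ^ k" .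
      \<comment> \<open>Replacing b^(1/(k+1)) by L^(1/(k+1)) leaves 1/b, whose sum gives the extra
        logarithm.\<close>
      have "(real Y / real b) powr s = real Y powr s * (real b powr (1 / real (Suc k)) * (1 / real b))"
        using b by (simp add: powr_divide s_def powr_diff)
      also have "\<dots> \<le> real Y powr s * (real L powr (1 / real (Suc k)) * (1 / real b))"
        using b by (intro mult_left_mono mult_right_mono powr_mono2) auto
      finally have "B * real q * (real Y / real b) powr s * l ^ k
          \<le> B * real q * (real Y powr s * (real L powr (1 / real (Suc k)) * (1 / real b))) * l ^ k"
        using B l by (intro mult_left_mono mult_right_mono) auto
      with * show "norm (\<Sum>a=1..Y div b. ?f a b)
        \<le> (B * real q * real Y powr s * real L powr (1 / real (Suc k)) * l ^ k) * (1 / real b)"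
        by (simp add: mult_ac)
    qed
    also have "\<dots> = (B * real q * real Y powr s * real L powr (1 / real (Suc k)) * l ^ k)
        * (\<Sum>b=1..L. 1 / real b)"
      by (simp add: sum_distrib_left)
    also have "\<dots> \<le> (B * real q * real Y powr s * (2 * real Y powr (1 / K * (1 / real (Suc k)))) * l ^ k) * l"
    proof (intro mult_mono)
      have "real L powr (1 / real (Suc k)) \<le> (2 * real Y powr (1 / K)) powr (1 / real (Suc k))"
        using Lle by (intro powr_mono2) auto
      also have "\<dots> = 2 powr (1 / real (Suc k)) * real Y powr (1 / K * (1 / real (Suc k)))"
        by (simp add: powr_mult powr_powr)
      also have "\<dots> \<le> 2 powr 1 * real Y powr (1 / K * (1 / real (Suc k)))"
        by (intro mult_right_mono powr_mono) auto
      finally show "real L powr (1 / real (Suc k)) \<le> 2 * real Y powr (1 / K * (1 / real (Suc k)))" by simp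
      show "(\<Sum>b=1..L. 1 / real b) \<le> l"
        using harm_le_ln[OF Lpos] LY Lpos Y unfolding l_def by (intro order_trans[OF harm_le_ln]) auto
    qed (use B l in \<open>auto intro!: sum_nonneg\<close>)
    also have "\<dots> = 2 * B * real q * (real Y powr s * real Y powr (1 / K * (1 / real (Suc k)))) * l ^ Suc k"
      by (simp add: mult_ac)
    also have "real Y powr s * real Y powr (1 / K * (1 / real (Suc k))) = real Y powr (1 - 1 / K)"
    proof -
      have "s + 1 / K * (1 / real (Suc k)) = 1 - 1 / K"
      proof -
        have "1 / (real k + 2) * (1 / (real k + 1)) = 1 / (real k + 1) - 1 / (real k + 2)"
          by (simp add: diff_frac_eq)
        then show ?thesis unfolding s_def K_def by (simp add: add.commute)
      qed
      then show ?thesis by (simp only: powr_add[symmetric])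
    qed
    finally have first: "norm (\<Sum>b=1..L. \<Sum>a=1..Y div b. ?f a b)
      \<le> 2 * B * real q * real Y powr (1 - 1 / K) * l ^ Suc k" .

    \<comment> \<open>The range L < b \<le> Y/a is a difference of two initial segments, each
      contributing at most 2 q.\<close>
    have inner: "norm (\<Sum>b=Suc L..Y div a. ?f a b) \<le> real (tau (Suc k) a) * (4 * real q)" for a
    proof (cases "L < Y div a")
      case True
      let ?h = "\<lambda>b. g (a * (u * b)) - g (a * b)"
      have seg: "norm (\<Sum>b=1..M. ?h b) \<le> 2 * real q" for M
        using norm_sum_dilation_le[of q "\<lambda>n. g (a * n)" u M] q cop by (simp add: per_mult bd)
      have "(\<Sum>b=1..Y div a. ?h b) = (\<Sum>b=1..L. ?h b) + (\<Sum>b=Suc L..Y div a. ?h b)"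
        using True sum.ub_add_nat[of 1 L ?h "Y div a - L"] by simp
      then have "norm (\<Sum>b=Suc L..Y div a. ?h b) \<le> 4 * real q"
        using norm_triangle_ineq4[of "\<Sum>b=1..Y div a. ?h b" "\<Sum>b=1..L. ?h b"] seg[of L] seg[of "Y div a"]
        by simp
      moreover have "(\<Sum>b=Suc L..Y div a. ?f a b) = of_nat (tau (Suc k) a) * (\<Sum>b=Suc L..Y div a. ?h b)"
        by (simp add: sum_distrib_left mult_ac)
      ultimately show ?thesis by (simp add: norm_mult mult_left_mono)
    qed simp
    \<comment> \<open>For a > Y/L no b > L satisfies a b \<le> Y, so the inner sum is empty.\<close>
    have "norm (\<Sum>a=1..Y. \<Sum>b=Suc L..Y div a. ?f a b) = norm (\<Sum>a=1..Y div L. \<Sum>b=Suc L..Y div a. ?f a b)"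
    proof (rule arg_cong[where f = norm], rule sum.mono_neutral_right)
      show "\<forall>a\<in>{1..Y} - {1..Y div L}. (\<Sum>b=Suc L..Y div a. ?f a b) = 0"
      proof
        fix a assume a: "a \<in> {1..Y} - {1..Y div L}"
        then have "\<not> a * L \<le> Y" using Lpos by (auto simp: less_eq_div_iff_mult_less_eq)
        then have "\<not> L \<le> Y div a" using a by (auto simp: less_eq_div_iff_mult_less_eq mult.commute)
        then show "(\<Sum>b=Suc L..Y div a. ?f a b) = 0" by simp
      qed
    qed (auto intro: order_trans[OF _ div_le_dividend])
    also have "\<dots> \<le> (\<Sum>a=1..Y div L. real (tau (Suc k) a) * (4 * real q))"
      by (rule order_trans[OF norm_sum], rule sum_mono, rule inner)
    also have "\<dots> = 4 * real q * (\<Sum>a=1..Y div L. real (tau (Suc k) a))"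
      by (simp add: sum_distrib_right[symmetric])
    also have "\<dots> \<le> 4 * real q * (real (Y div L) * (1 + ln (real (Y div L))) ^ k)"
      by (intro mult_left_mono sum_tau_le) auto
    also have "\<dots> \<le> 4 * real q * (real Y powr (1 - 1 / K) * l ^ Suc k)"
    proof (intro mult_left_mono mult_mono)
      have "real (Y div L) \<le> real Y / real L" by (rule of_nat_div_le_of_nat)
      also have "\<dots> \<le> real Y / real Y powr (1 / K)"
        using Lge Lpos Y by (intro divide_left_mono mult_pos_pos) auto
      also have "\<dots> = real Y powr (1 - 1 / K)" using Y by (simp add: powr_diff)
      finally show "real (Y div L) \<le> real Y powr (1 - 1 / K)" .
      have d: "Y div L > 0" "Y div L \<le> Y" using LY Lpos by (auto simp: div_greater_zero_iff)
      have "(1 + ln (real (Y div L))) ^ k \<le> l ^ k"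
        unfolding l_def using d by (intro power_mono add_left_mono ln_mono) auto
      also have "\<dots> \<le> l ^ Suc k" using l by (intro power_increasing) auto
      finally show "(1 + ln (real (Y div L))) ^ k \<le> l ^ Suc k" .
      show "(1 + ln (real (Y div L))) ^ k \<ge> 0" using d by simp
    qed auto
    finally have second: "norm (\<Sum>a=1..Y. \<Sum>b=Suc L..Y div a. ?f a b)
      \<le> 4 * real q * (real Y powr (1 - 1 / K) * l ^ Suc k)" .
    show "norm (\<Sum>n=1..Y. of_nat (tau (Suc (Suc k)) n) * (g (u * n) - g n))
       \<le> (2 * B + 4) * real q * real Y powr (1 - 1 / real (Suc (Suc k))) * (1 + ln (real Y)) ^ Suc k"
      unfolding split K_def[symmetric] l_def[symmetric]
      using norm_triangle_ineq[of "\<Sum>b=1..L. \<Sum>a=1..Y div b. ?f a b" "\<Sum>a=1..Y. \<Sum>b=Suc L..Y div a. ?f a b"]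
        first second by (simp add: algebra_simps)
  qed (use B in simp)
qed

section \<open>The large sieve\<close>

text \<open>Gallagher's form of the Sobolev inequality: a value at the centre is at most the mean
  over the window plus the variation on it. A continuous majorant G of |g'| keeps the integrand
  continuous, although continuity of g' is not assumed.\<close>

lemma sobolev_point_bound:
  fixes g g' G :: "real \<Rightarrow> real"
  assumes h: "h > 0" and deriv: "\<And>y. (g has_real_derivative g' y) (at y)"
    and bound: "\<And>y. \<bar>g' y\<bar> \<le> G y" and cont: "continuous_on UNIV G"
  shows "g x \<le> integral {x - h..x + h} (\<lambda>y. g y / (2 * h) + G y)"
proof -
  let ?I = "{x - h..x + h}"
  have cg: "continuous_on S g" for S
    using deriv by (meson DERIV_isCont continuous_at_imp_continuous_on)
  have cG: "continuous_on S G" for S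
    using cont continuous_on_subset by blast
  have iG: "G integrable_on {a..b}" for a b by (intro integrable_continuous_interval cG)
  have ig: "g integrable_on {a..b}" for a b by (intro integrable_continuous_interval cg)
  have G0: "G y \<ge> 0" for y using bound[of y] by simp
  have var: "g v - g u \<le> integral ?I G" "g u - g v \<le> integral ?I G"
    if "x - h \<le> u" "u \<le> v" "v \<le> x + h" for u v
  proof -
    have ftc: "(g' has_integral (g v - g u)) {u..v}"
      using that deriv by (intro fundamental_theorem_of_calculus)
        (auto simp: has_real_derivative_iff_has_vector_derivative[symmetric] intro: has_field_derivative_at_within)
    have sub: "integral {u..v} G \<le> integral ?I G"
      using that G0 by (intro integral_subset_le iG) auto
    have "g v - g u \<le> integral {u..v} G"
      using bound by (intro has_integral_le[OF ftc integrable_integral[OF iG]]) (simp add: abs_le_iff)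
    then show "g v - g u \<le> integral ?I G" using sub by simp
    have "- (g v - g u) \<le> integral {u..v} G"
      using bound by (intro has_integral_le[OF has_integral_neg[OF ftc] integrable_integral[OF iG]])
        (simp add: abs_le_iff)
    then show "g u - g v \<le> integral ?I G" using sub by simp
  qed
  \<comment> \<open>It remains to average this lower bound for g y over the window, which has length
    2 h.\<close>
  have pt: "g x - integral ?I G \<le> g y" if "y \<in> ?I" for y
    using var[of x y] var[of y x] that by (cases "x \<le> y") auto
  have "integral ?I (\<lambda>_. g x - integral ?I G) \<le> integral ?I g"
    by (intro integral_le ig integrable_continuous_interval continuous_intros pt)
  then have "2 * h * (g x - integral ?I G) \<le> integral ?I g" using h by simp
  then have "g x \<le> integral ?I g / (2 * h) + integral ?I G"
    using h by (simp add: field_simps)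
  also have "\<dots> = integral ?I (\<lambda>y. g y / (2 * h) + G y)"
    using h by (subst integral_add) (auto intro!: iG integrable_continuous_interval continuous_intros cg)
  finally show ?thesis .
qed

text \<open>Windows of half-width h around points 2 h apart meet at most in an endpoint, and they
  stay inside the unit interval, so no reduction modulo 1 occurs.\<close>

lemma sum_separated_integrals_le:
  fixes W :: "real \<Rightarrow> real" and x :: "'a \<Rightarrow> real"
  assumes "finite I" and "continuous_on UNIV W" and "\<And>y. W y \<ge> 0"
    and inside: "\<And>i. i \<in> I \<Longrightarrow> h \<le> x i \<and> x i \<le> 1 - h"
    and sep: "\<And>i j. i \<in> I \<Longrightarrow> j \<in> I \<Longrightarrow> i \<noteq> j \<Longrightarrow> \<bar>x i - x j\<bar> \<ge> 2 * h"
  shows "(\<Sum>i\<in>I. integral {x i - h..x i + h} W) \<le> integral {0..1} W"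
proof -
  have int: "W integrable_on {a..b}" for a b
    using assms(2) by (intro integrable_continuous_interval) (meson continuous_on_subset subset_UNIV)
  have neg: "negligible ({x i - h..x i + h} \<inter> {x j - h..x j + h})" if "i \<in> I" "j \<in> I" "i \<noteq> j" for i j
  proof (rule negligible_subset)
    show "negligible {x i + h, x j + h}" by simp
    show "{x i - h..x i + h} \<inter> {x j - h..x j + h} \<subseteq> {x i + h, x j + h}"
      using sep[OF that] by (auto simp: abs_if split: if_splits)
  qed
  have "(W has_integral (\<Sum>i\<in>I. integral {x i - h..x i + h} W)) (\<Union>i\<in>I. {x i - h..x i + h})"
    using neg by (intro has_integral_UN assms(1) integrable_integral int) (auto simp: pairwise_def)
  moreover have "(\<Union>i\<in>I. {x i - h..x i + h}) \<subseteq> {0..1}"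
    using inside by fastforce
  ultimately show ?thesis
    using assms(3) by (intro has_integral_subset_le[OF _ _ integrable_integral[OF int]]) auto
qed

lemma has_integral_cos_int:
  fixes m n :: nat
  shows "((\<lambda>x. cos (2 * pi * (real m - real n) * x)) has_integral (if m = n then 1 else 0)) {0..1}"
proof (cases "m = n")
  case True
  then show ?thesis using has_integral_const_real[of "1::real" 0 1] by simp
next
  case False
  define c where "c = 2 * pi * (real m - real n)"
  have c: "c \<noteq> 0" using False by (simp add: c_def)
  have "sin c = 0"
    using sin_int_2pin[of "int m - int n"] by (simp add: c_def mult_ac)
  have "((\<lambda>x. cos (c * x)) has_integral (sin (c * 1) / c - sin (c * 0) / c)) {0..1}"
    by (rule fundamental_theorem_of_calculus)
      (auto simp: has_real_derivative_iff_has_vector_derivative[symmetric] c intro!: derivative_eq_intros)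
  then show ?thesis using False \<open>sin c = 0\<close> by (simp add: c_def)
qed

text \<open>Parseval for the squared modulus of a trigonometric sum, written by real and imaginary
  parts. The addition formula for the cosine turns it into a double sum of which only the diagonal
  survives integration.\<close>

lemma has_integral_trig_energy:
  fixes a :: "nat \<Rightarrow> real"
  shows "((\<lambda>x. (\<Sum>n=1..N. a n * cos (2 * pi * real n * x))\<^sup>2 + (\<Sum>n=1..N. a n * sin (2 * pi * real n * x))\<^sup>2)
    has_integral (\<Sum>n=1..N. (a n)\<^sup>2)) {0..1}"
proof -
  have eq: "(\<Sum>n=1..N. a n * cos (2 * pi * real n * x))\<^sup>2 + (\<Sum>n=1..N. a n * sin (2 * pi * real n * x))\<^sup>2
    = (\<Sum>m=1..N. \<Sum>n=1..N. a m * a n * cos (2 * pi * (real m - real n) * x))" for x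
  proof -
    have "cos (2 * pi * (real m - real n) * x) = cos (2 * pi * real m * x) * cos (2 * pi * real n * x)
        + sin (2 * pi * real m * x) * sin (2 * pi * real n * x)" for m n
      by (simp add: cos_diff[symmetric] algebra_simps)
    then show ?thesis
      by (simp add: power2_eq_square sum_product sum.distrib[symmetric] algebra_simps)
  qed
  have "((\<lambda>x. \<Sum>m=1..N. \<Sum>n=1..N. a m * a n * cos (2 * pi * (real m - real n) * x))
      has_integral (\<Sum>m=1..N. \<Sum>n=1..N. a m * a n * (if m = n then 1 else 0))) {0..1}"
    by (intro has_integral_sum has_integral_mult_right has_integral_cos_int) auto
  also have "(\<Sum>m=1..N. \<Sum>n=1..N. a m * a n * (if m = n then 1 else 0)) = (\<Sum>n=1..N. (a n)\<^sup>2)"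
    by (intro sum.cong) (auto simp: if_distrib[of "\<lambda>t. _ * t"] power2_eq_square cong: if_cong)
  finally show ?thesis unfolding eq .
qed

section \<open>Exponential sums at well-spaced points and at Farey fractions\<close>

definition expsum :: "(nat \<Rightarrow> real) \<Rightarrow> nat \<Rightarrow> real \<Rightarrow> complex" where
  "expsum a N x = (\<Sum>n=1..N. of_real (a n) * cis (2 * pi * real n * x))"

lemma norm_expsum:
  "(norm (expsum a N x))\<^sup>2 = (\<Sum>n=1..N. a n * cos (2 * pi * real n * x))\<^sup>2 + (\<Sum>n=1..N. a n * sin (2 * pi * real n * x))\<^sup>2"
  by (simp add: cmod_power2 expsum_def)

text \<open>Gallagher's proof: bound each value by a local integral, fit the disjoint windows into
  the unit interval and integrate there by Parseval.\<close>

lemma large_sieve: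
  fixes a :: "nat \<Rightarrow> real" and x :: "'a \<Rightarrow> real"
  assumes "finite I" and h: "h > 0" and N: "N > 0"
    and inside: "\<And>i. i \<in> I \<Longrightarrow> h \<le> x i \<and> x i \<le> 1 - h"
    and sep: "\<And>i j. i \<in> I \<Longrightarrow> j \<in> I \<Longrightarrow> i \<noteq> j \<Longrightarrow> \<bar>x i - x j\<bar> \<ge> 2 * h"
  shows "(\<Sum>i\<in>I. (norm (expsum a N (x i)))\<^sup>2) \<le> (1 / (2 * h) + 50 * real N) * (\<Sum>n=1..N. (a n)\<^sup>2)"
proof -
  define b where "b = (\<lambda>n. 2 * pi * real n * a n)"
  \<comment> \<open>\<open>C'\<close> and \<open>S'\<close> are the cosine and sine sums with
    coefficients b, so the derivative of C is - \<open>S'\<close> and that of S is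
    \<open>C'\<close>.\<close>
  define C S C' S' where "C = (\<lambda>y. \<Sum>n=1..N. a n * cos (2 * pi * real n * y))"
    and "S = (\<lambda>y. \<Sum>n=1..N. a n * sin (2 * pi * real n * y))"
    and "C' = (\<lambda>y. \<Sum>n=1..N. b n * cos (2 * pi * real n * y))"
    and "S' = (\<lambda>y. \<Sum>n=1..N. b n * sin (2 * pi * real n * y))"
  \<comment> \<open>G comes from |2uv| \<le> N u^2 + v^2/N. As differentiation costs a factor of
    order N, both parts of G then have mean of order N E.\<close>
  define g g' G where "g = (\<lambda>y. (C y)\<^sup>2 + (S y)\<^sup>2)"
    and "g' = (\<lambda>y. 2 * C y * (- S' y) + 2 * S y * C' y)"
    and "G = (\<lambda>y. real N * g y + ((C' y)\<^sup>2 + (S' y)\<^sup>2) / real N)"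
  define E where "E = (\<Sum>n=1..N. (a n)\<^sup>2)"
  have dC: "(C has_real_derivative - S' y) (at y)" for y
    unfolding C_def S'_def b_def
    by (auto intro!: derivative_eq_intros sum.cong simp: sum_negf[symmetric] mult_ac)
  have dS: "(S has_real_derivative C' y) (at y)" for y
    unfolding S_def C'_def b_def by (auto intro!: derivative_eq_intros sum.cong simp: mult_ac)
  have dg: "(g has_real_derivative g' y) (at y)" for y
    unfolding g_def g'_def by (auto intro!: derivative_eq_intros dC dS)
  have AG: "\<bar>2 * u * v\<bar> \<le> real N * u\<^sup>2 + v\<^sup>2 / real N" for u v :: real
  proof -
    have "0 \<le> (real N * \<bar>u\<bar> - \<bar>v\<bar>)\<^sup>2" by simp
    then have "real N * (2 * \<bar>u\<bar> * \<bar>v\<bar>) \<le> (real N)\<^sup>2 * u\<^sup>2 + v\<^sup>2"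
      by (simp add: power2_diff power_mult_distrib algebra_simps)
    then show ?thesis using N by (simp add: field_simps abs_mult power2_eq_square)
  qed
  have bound: "\<bar>g' y\<bar> \<le> G y" for y
    using AG[of "C y" "- S' y"] AG[of "S y" "C' y"] abs_triangle_ineq[of "2 * C y * (- S' y)" "2 * S y * C' y"]
    unfolding g'_def G_def g_def by (simp add: algebra_simps add_divide_distrib)
  have cont: "continuous_on UNIV C" "continuous_on UNIV S" "continuous_on UNIV C'" "continuous_on UNIV S'"
    unfolding C_def S_def C'_def S'_def by (intro continuous_intros)+
  have cG: "continuous_on UNIV G" and cg: "continuous_on UNIV g"
    unfolding G_def g_def using N by (auto intro!: continuous_intros cont)
  let ?W = "\<lambda>y. g y / (2 * h) + G y"
  have "(\<Sum>i\<in>I. (norm (expsum a N (x i)))\<^sup>2) = (\<Sum>i\<in>I. g (x i))"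
    by (simp add: norm_expsum g_def C_def S_def)
  also have "\<dots> \<le> (\<Sum>i\<in>I. integral {x i - h..x i + h} ?W)"
    by (intro sum_mono sobolev_point_bound[OF h dg bound cG])
  also have "\<dots> \<le> integral {0..1} ?W"
  proof (rule sum_separated_integrals_le[OF \<open>finite I\<close> _ _ inside sep])
    show "continuous_on UNIV ?W" using h by (intro continuous_intros cg cG) auto
    show "?W y \<ge> 0" for y using h unfolding G_def g_def by simp
  qed
  also have "\<dots> = E / (2 * h) + (real N * E + (\<Sum>n=1..N. (b n)\<^sup>2) / real N)"
    unfolding G_def
  proof (intro integral_unique has_integral_add has_integral_divide has_integral_mult_right)
    show "(g has_integral E) {0..1}" unfolding g_def C_def S_def E_def by (rule has_integral_trig_energy)
    then show "(g has_integral E) {0..1}" .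
    show "((\<lambda>y. (C' y)\<^sup>2 + (S' y)\<^sup>2) has_integral (\<Sum>n=1..N. (b n)\<^sup>2)) {0..1}"
      unfolding C'_def S'_def by (rule has_integral_trig_energy)
  qed
  also have "\<dots> \<le> E / (2 * h) + (real N * E + 40 * real N * E)"
  proof -
    \<comment> \<open>Differentiation brings in (2 pi n)^2 \<le> 40 N^2. The total 1 + 40 is rounded
      up to 50.\<close>
    have "pi < 3.15" using pi_approx by simp
    then have "pi\<^sup>2 \<le> 3.15\<^sup>2" by (intro power_mono) auto
    then have pi: "4 * pi\<^sup>2 \<le> 40" by (simp add: power2_eq_square)
    have "(\<Sum>n=1..N. (b n)\<^sup>2) \<le> (\<Sum>n=1..N. 40 * (real N)\<^sup>2 * (a n)\<^sup>2)"
    proof (rule sum_mono)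
      fix n assume n: "n \<in> {1..N}"
      have "(b n)\<^sup>2 = 4 * pi\<^sup>2 * (real n)\<^sup>2 * (a n)\<^sup>2" by (simp add: b_def power_mult_distrib)
      also have "\<dots> \<le> 40 * (real N)\<^sup>2 * (a n)\<^sup>2"
        using n pi by (intro mult_right_mono mult_mono power_mono) auto
      finally show "(b n)\<^sup>2 \<le> 40 * (real N)\<^sup>2 * (a n)\<^sup>2" .
    qed
    then have "(\<Sum>n=1..N. (b n)\<^sup>2) / real N \<le> 40 * real N * E"
      using N unfolding E_def sum_distrib_left[symmetric] by (simp add: divide_simps power2_eq_square mult_ac)
    then show ?thesis by (simp add: mult_ac)
  qed
  also have "\<dots> \<le> (1 / (2 * h) + 50 * real N) * E"
  proof -
    have "real N * E \<ge> 0" unfolding E_def by (intro mult_nonneg_nonneg sum_nonneg) auto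
    then show ?thesis by (simp add: algebra_simps)
  qed
  finally show ?thesis unfolding E_def .
qed

definition farey_energy :: "(nat \<Rightarrow> real) \<Rightarrow> nat \<Rightarrow> nat \<Rightarrow> real" where
  "farey_energy a N q = (\<Sum>b | b < q \<and> coprime b q. (norm (expsum a N (real b / real q)))\<^sup>2)"

lemma farey_energy_nonneg: "farey_energy a N q \<ge> 0"
  unfolding farey_energy_def by (intro sum_nonneg) auto

text \<open>Distinct reduced fractions b/q and c/r differ by at least 1/(q r) \<ge> 1/Q^2. Starting
  at q = 2 excludes the point 0, so every window lies in the unit interval; the denominator 1 always
  belongs to the low frequencies later on.\<close>

lemma large_sieve_farey:
  assumes N: "N > 0"
  shows "(\<Sum>q=2..Q. farey_energy a N q) \<le> 50 * (real N + (real Q)\<^sup>2) * (\<Sum>n=1..N. (a n)\<^sup>2)"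
proof (cases "Q < 2")
  case True
  then show ?thesis by (auto intro!: mult_nonneg_nonneg sum_nonneg)
next
  case False
  define I where "I = Sigma {2..Q} (\<lambda>q. {b. b < q \<and> coprime b q})"
  define x where "x = (\<lambda>(q, b). real b / real q)"
  define h where "h = 1 / (2 * (real Q)\<^sup>2)"
  have Q: "Q \<ge> 2" using False by simp
  have fin: "finite I" unfolding I_def by auto
  have h: "h > 0" using Q by (simp add: h_def)
  have hq: "2 * h \<le> 1 / (real q * real r)" if "0 < q" "q \<le> Q" "0 < r" "r \<le> Q" for q r
  proof -
    have "real q * real r \<le> real Q * real Q" using that by (intro mult_mono) auto
    then show ?thesis using that Q unfolding h_def by (simp add: field_simps power2_eq_square)
  qed
  have "(\<Sum>q=2..Q. farey_energy a N q) = (\<Sum>i\<in>I. (norm (expsum a N (x i)))\<^sup>2)"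
    unfolding farey_energy_def I_def x_def by (subst sum.Sigma) (auto simp: case_prod_beta)
  also have "\<dots> \<le> (1 / (2 * h) + 50 * real N) * (\<Sum>n=1..N. (a n)\<^sup>2)"
  proof (rule large_sieve[OF fin h N])
    fix i assume "i \<in> I"
    then obtain q b where i: "i = (q, b)" "2 \<le> q" "q \<le> Q" "b < q" "coprime b q"
      unfolding I_def by auto
    have b: "b > 0" using i by (auto intro!: Nat.gr0I)
    have *: "h \<le> 1 / real q" using hq[of q 1] h i Q by simp
    have "1 / real q \<le> real b / real q" using b i by (simp add: divide_right_mono)
    moreover have "real b / real q \<le> 1 - 1 / real q"
    proof -
      have "real b + 1 \<le> real q" using i by linarith
      then show ?thesis using i by (simp add: field_simps)
    qed
    ultimately show "h \<le> x i \<and> x i \<le> 1 - h" using * i(1) unfolding x_def by auto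
  next
    fix i j assume "i \<in> I" "j \<in> I" "i \<noteq> j"
    from \<open>i \<in> I\<close> obtain q b where i: "i = (q, b)" "2 \<le> q" "q \<le> Q" "b < q" "coprime b q"
      unfolding I_def by auto
    from \<open>j \<in> I\<close> obtain r c where j: "j = (r, c)" "2 \<le> r" "r \<le> Q" "c < r" "coprime c r"
      unfolding I_def by auto
    have ne: "(q, b) \<noteq> (r, c)" using \<open>i \<noteq> j\<close> i j by simp
    have "b * r \<noteq> c * q"
    proof
      assume eq: "b * r = c * q"
      have "q dvd r" using eq i(5) by (metis coprime_commute coprime_dvd_mult_right_iff dvd_triv_right)
      moreover have "r dvd q" using eq j(5) by (metis coprime_commute coprime_dvd_mult_right_iff dvd_triv_right)
      ultimately have "q = r" by (rule dvd_antisym)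
      then show False using eq ne i by simp
    qed
    \<comment> \<open>The cross products are distinct integers, hence at least 1 apart.\<close>
    then have "\<bar>int (b * r) - int (c * q)\<bar> \<ge> 1" by linarith
    then have num: "\<bar>real (b * r) - real (c * q)\<bar> \<ge> 1" by linarith
    have "x i - x j = (real (b * r) - real (c * q)) / (real q * real r)"
      using i j unfolding x_def by (simp add: field_simps)
    then have "\<bar>x i - x j\<bar> = \<bar>real (b * r) - real (c * q)\<bar> / (real q * real r)"
      by (simp add: abs_divide abs_mult)
    also have "\<dots> \<ge> 1 / (real q * real r)" using num by (intro divide_right_mono) auto
    finally show "\<bar>x i - x j\<bar> \<ge> 2 * h" using hq[of q r] i j by simp
  qed
  also have "1 / (2 * h) = (real Q)\<^sup>2" by (simp add: h_def)
  also have "((real Q)\<^sup>2 + 50 * real N) * (\<Sum>n=1..N. (a n)\<^sup>2) \<le> 50 * (real N + (real Q)\<^sup>2) * (\<Sum>n=1..N. (a n)\<^sup>2)"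
    by (intro mult_right_mono sum_nonneg) auto
  finally show ?thesis .
qed

section \<open>Fourier analysis modulo d\<close>

text \<open>The additive character e(m/d). Its argument is an integer because phases such as -b r
  and (n - r) b occur.\<close>

definition unity_char :: "nat \<Rightarrow> int \<Rightarrow> complex" where
  "unity_char d m = cis (2 * pi * real_of_int m / real d)"

lemma unity_char_add: "unity_char d (m + n) = unity_char d m * unity_char d n"
  by (simp add: unity_char_def cis_mult algebra_simps add_divide_distrib)

lemma norm_unity_char [simp]: "norm (unity_char d m) = 1"
  by (simp add: unity_char_def)

lemma cnj_unity_char: "cnj (unity_char d m) = unity_char d (- m)"
  by (simp add: unity_char_def cis_cnj)

lemma unity_char_eq_1_iff:
  assumes "d > 0"
  shows "unity_char d m = 1 \<longleftrightarrow> int d dvd m"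
proof -
  have "unity_char d m = 1 \<longleftrightarrow> (\<exists>n. 2 * pi * real_of_int m / real d = real_of_int (2 * n) * pi)"
    by (simp add: unity_char_def cis_conv_exp exp_eq_1)
  also have "\<dots> \<longleftrightarrow> (\<exists>n. real_of_int m = real_of_int (int d * n))"
    using assms by (intro ex_cong1) (auto simp: field_simps)
  also have "\<dots> \<longleftrightarrow> int d dvd m"
    by (simp only: of_int_eq_iff dvd_def)
  finally show ?thesis .
qed

lemma unity_char_period:
  assumes "d > 0" "int d dvd m - n"
  shows "unity_char d m = unity_char d n"
  using unity_char_add[of d "m - n" n] unity_char_eq_1_iff[OF assms(1), of "m - n"] assms(2) by simp

lemma sum_unity_char:
  assumes "d > 0"
  shows "(\<Sum>b<d. unity_char d (m * int b)) = (if int d dvd m then of_nat d else 0)"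
proof -
  have pow: "unity_char d (m * int b) = unity_char d m ^ b" for b
    by (induction b) (simp_all add: unity_char_add algebra_simps, simp add: unity_char_def)
  show ?thesis
  proof (cases "int d dvd m")
    case True
    then show ?thesis using unity_char_eq_1_iff[OF assms, of m] by (simp add: pow)
  next
    case False
    have "unity_char d m ^ d = 1"
      using unity_char_eq_1_iff[OF assms, of "m * int d"] by (simp add: pow[symmetric])
    moreover have "unity_char d m \<noteq> 1" using False unity_char_eq_1_iff[OF assms] by simp
    ultimately show ?thesis using False by (simp add: pow geometric_sum)
  qed
qed

lemma expsum_frac:
  "expsum a N (real b / real d) = (\<Sum>n=1..N. of_real (a n) * unity_char d (int n * int b))"
  by (simp add: expsum_def unity_char_def mult_ac)

text \<open>After opening the square, the sum over r detects b = b'. An arbitrary frequency set A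
  allows restriction to the high frequencies.\<close>

lemma parseval_mod:
  assumes d: "d > 0" and A: "A \<subseteq> {..<d}"
  shows "(\<Sum>r<d. (norm (\<Sum>b\<in>A. c b * unity_char d (- int b * int r)))\<^sup>2) = real d * (\<Sum>b\<in>A. (norm (c b))\<^sup>2)"
proof -
  have fin: "finite A" using A finite_subset by blast
  \<comment> \<open>Two elements of A differ by less than d, so congruent ones coincide.\<close>
  have eq: "int d dvd int b' - int b \<longleftrightarrow> b' = b" if "b \<in> A" "b' \<in> A" for b b'
  proof
    assume "int d dvd int b' - int b"
    moreover have "\<bar>int b' - int b\<bar> < int d" using that A by (auto simp: abs_if)
    ultimately show "b' = b" using dvd_imp_le_int[of "int b' - int b" "int d"] by force
  qed simp
  have "complex_of_real (\<Sum>r<d. (norm (\<Sum>b\<in>A. c b * unity_char d (- int b * int r)))\<^sup>2)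
    = (\<Sum>r<d. \<Sum>b\<in>A. \<Sum>b'\<in>A. c b * cnj (c b') * unity_char d ((int b' - int b) * int r))"
  proof (simp only: of_real_sum, intro sum.cong refl)
    fix r
    have "complex_of_real ((norm (\<Sum>b\<in>A. c b * unity_char d (- int b * int r)))\<^sup>2)
      = (\<Sum>b\<in>A. c b * unity_char d (- int b * int r)) * (\<Sum>b'\<in>A. cnj (c b') * unity_char d (int b' * int r))"
      unfolding complex_norm_square by (simp add: cnj_unity_char)
    also have "\<dots> = (\<Sum>b\<in>A. \<Sum>b'\<in>A. c b * cnj (c b') * unity_char d ((int b' - int b) * int r))"
      unfolding sum_product
    proof (intro sum.cong refl)
      fix b b'
      have "unity_char d ((int b' - int b) * int r) = unity_char d (- int b * int r) * unity_char d (int b' * int r)"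
        by (simp add: unity_char_add[symmetric] algebra_simps)
      then show "c b * unity_char d (- int b * int r) * (cnj (c b') * unity_char d (int b' * int r))
        = c b * cnj (c b') * unity_char d ((int b' - int b) * int r)" by simp
    qed
    finally show "complex_of_real ((norm (\<Sum>b\<in>A. c b * unity_char d (- int b * int r)))\<^sup>2)
      = (\<Sum>b\<in>A. \<Sum>b'\<in>A. c b * cnj (c b') * unity_char d ((int b' - int b) * int r))" .
  qed
  also have "\<dots> = (\<Sum>b\<in>A. \<Sum>b'\<in>A. \<Sum>r<d. c b * cnj (c b') * unity_char d ((int b' - int b) * int r))"
    by (rule trans[OF sum.swap]) (intro sum.cong refl sum.swap)
  also have "\<dots> = (\<Sum>b\<in>A. \<Sum>b'\<in>A. c b * cnj (c b') * (if b' = b then of_nat d else 0))"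
    by (intro sum.cong refl) (simp add: sum_distrib_left[symmetric] sum_unity_char[OF d] eq)
  also have "\<dots> = (\<Sum>b\<in>A. of_real (real d * (norm (c b))\<^sup>2))"
    using fin by (intro sum.cong refl)
      (simp add: if_distrib[of "\<lambda>t. _ * t"] complex_norm_square[symmetric] mult.commute cong: if_cong)
  also have "\<dots> = complex_of_real (real d * (\<Sum>b\<in>A. (norm (c b))\<^sup>2))"
    by (simp add: sum_distrib_left)
  finally show ?thesis by (simp only: of_real_eq_iff)
qed

text \<open>The congruence is detected by orthogonality of the additive characters modulo d.\<close>

lemma sum_residue_class_eq:
  assumes d: "d > 0"
  shows "of_real (\<Sum>n | n \<in> {1..N} \<and> [n = r] (mod d). a n)
    = (\<Sum>b<d. expsum a N (real b / real d) * unity_char d (- int b * int r)) / of_nat d"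
proof -
  have "(\<Sum>b<d. expsum a N (real b / real d) * unity_char d (- int b * int r))
    = (\<Sum>b<d. \<Sum>n=1..N. of_real (a n) * unity_char d ((int n - int r) * int b))"
    unfolding expsum_frac sum_distrib_right
    by (intro sum.cong refl) (simp add: mult.assoc unity_char_add[symmetric] algebra_simps)
  also have "\<dots> = (\<Sum>n=1..N. of_real (a n) * (\<Sum>b<d. unity_char d ((int n - int r) * int b)))"
    by (subst sum.swap) (simp add: sum_distrib_left)
  also have "\<dots> = (\<Sum>n=1..N. if [n = r] (mod d) then of_real (a n) * of_nat d else 0)"
    by (intro sum.cong refl)
      (simp add: sum_unity_char[OF d] cong_iff_dvd_diff[symmetric] cong_int_iff)
  also have "\<dots> = of_real (\<Sum>n | n \<in> {1..N} \<and> [n = r] (mod d). a n) * of_nat d"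
    by (simp add: sum.inter_filter[symmetric] sum_distrib_right)
  finally show ?thesis using d by simp
qed

text \<open>Reducing b/d to lowest terms gives the denominator \<open>d div gcd b d\<close>; the
  inverse map sends b/q to \<open>b * (d div q)\<close>. The frequency 0 becomes 0/1.\<close>

lemma sum_fractions_by_denominator:
  fixes f :: "real \<Rightarrow> real"
  assumes d: "d > 0"
  shows "(\<Sum>b | b < d \<and> P (d div gcd b d). f (real b / real d))
    = (\<Sum>q | q dvd d \<and> P q. \<Sum>b | b < q \<and> coprime b q. f (real b / real q))"
proof -
  have "(\<Sum>q | q dvd d \<and> P q. \<Sum>b | b < q \<and> coprime b q. f (real b / real q))
    = (\<Sum>(q,b)\<in>Sigma {q. q dvd d \<and> P q} (\<lambda>q. {b. b < q \<and> coprime b q}). f (real b / real q))"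
    using d by (subst sum.Sigma) auto
  also have "\<dots> = (\<Sum>b | b < d \<and> P (d div gcd b d). f (real b / real d))"
  proof (rule sum.reindex_bij_witness[of _ "\<lambda>b. (d div gcd b d, b div gcd b d)" "\<lambda>(q,b). b * (d div q)"], goal_cases)
    case (1 x)
    then obtain q b where x: "x = (q, b)" "q dvd d" "P q" "b < q" "coprime b q" by auto
    then obtain e where e: "d = q * e" by (auto elim: dvdE)
    have pos: "q > 0" "e > 0" using d e by auto
    have "gcd (b * e) (q * e) = e"
      using x(5) by (simp add: gcd_mult_distrib_nat[symmetric] mult.commute[of _ e])
    then show ?case using x pos e by simp
  next
    case (2 x)
    then obtain q b where x: "x = (q, b)" "q dvd d" "P q" "b < q" "coprime b q" by auto
    then obtain e where e: "d = q * e" by (auto elim: dvdE)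
    have pos: "q > 0" "e > 0" using d e by auto
    have "gcd (b * e) (q * e) = e"
      using x(5) by (simp add: gcd_mult_distrib_nat[symmetric] mult.commute[of _ e])
    then show ?case using x pos e by simp
  next
    case (3 b)
    have "d div (d div g) = g" if "g dvd d" for g using that d by (auto elim!: dvdE)
    then have "d div (d div gcd b d) = gcd b d" by simp
    then show ?case by simp
  next
    case (4 b)
    have g: "gcd b d > 0" using d by simp
    have "coprime (b div gcd b d) (d div gcd b d)" using g by (intro div_gcd_coprime) auto
    moreover have "b div gcd b d < d div gcd b d" using 4 g by (intro div_less_mono) auto
    moreover have "d div gcd b d dvd d" by (metis dvd_div_mult_self dvd_triv_left gcd_dvd2)
    ultimately show ?case using 4 by auto
  next
    case (5 x)
    then obtain q b where x: "x = (q, b)" "q dvd d" "P q" "b < q" "coprime b q" by auto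
    then obtain e where e: "d = q * e" by (auto elim: dvdE)
    have pos: "q > 0" "e > 0" using d e by auto
    then show ?case using x e by simp
  qed
  finally show ?thesis by simp
qed

section \<open>The variance for one modulus\<close>

text \<open>The mean minimises the sum of squared deviations, and for real data a complex centre
  does no better than its real part. The centre will be a complex low-frequency sum.\<close>

lemma sum_variance_le:
  fixes f :: "'a \<Rightarrow> real"
  assumes "finite A" "A \<noteq> {}"
  shows "(\<Sum>x\<in>A. (f x - (\<Sum>y\<in>A. f y) / real (card A))\<^sup>2) \<le> (\<Sum>x\<in>A. (norm (of_real (f x) - c :: complex))\<^sup>2)"
proof -
  define m where "m = (\<Sum>y\<in>A. f y) / real (card A)"
  have "card A > 0" using assms by (simp add: card_gt_0_iff)
  then have zero: "(\<Sum>x\<in>A. f x - m) = 0" by (simp add: sum_subtractf m_def)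
  have "(\<Sum>x\<in>A. (f x - Re c)\<^sup>2)
    = (\<Sum>x\<in>A. (f x - m)\<^sup>2 + 2 * (m - Re c) * (f x - m) + (m - Re c)\<^sup>2)"
    by (intro sum.cong refl) (simp add: power2_eq_square algebra_simps)
  also have "\<dots> = (\<Sum>x\<in>A. (f x - m)\<^sup>2) + real (card A) * (m - Re c)\<^sup>2"
    by (simp add: sum.distrib sum_distrib_left[symmetric] zero)
  finally have "(\<Sum>x\<in>A. (f x - m)\<^sup>2) \<le> (\<Sum>x\<in>A. (f x - Re c)\<^sup>2)" by simp
  also have "\<dots> \<le> (\<Sum>x\<in>A. (norm (of_real (f x) - c :: complex))\<^sup>2)"
    by (intro sum_mono) (simp add: cmod_power2)
  finally show ?thesis unfolding m_def .
qed

text \<open>Grouping the n coprime to d by residue class exhibits \<open>Delta\<close> as the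
  deviation of a class sum from the mean over the unit classes.\<close>

lemma Delta_eq:
  assumes "d > 0"
  shows "Delta f X d a = (\<Sum>n | n \<in> {1..nat \<lfloor>X\<rfloor>} \<and> [n = a] (mod d). f n)
    - (\<Sum>r | r \<in> {1..d} \<and> coprime r d. \<Sum>n | n \<in> {1..nat \<lfloor>X\<rfloor>} \<and> [n = r] (mod d). f n)
        / real (card {r \<in> {1..d}. coprime r d})"
proof -
  let ?N = "nat \<lfloor>X\<rfloor>" and ?U = "{r. r \<in> {1..d} \<and> coprime r d}"
  have le: "real n \<le> X \<longleftrightarrow> n \<le> ?N" if "n > 0" for n
  proof
    assume "n \<le> ?N"
    then show "real n \<le> X" using that by linarith
  qed (rule le_nat_floor)
  have set1: "{n. 0 < n \<and> real n \<le> X \<and> P n} = {n. n \<in> {1..?N} \<and> P n}" for P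
    using le by (auto simp: Suc_le_eq)
  have U: "?U = totatives d" by (auto simp: totatives_def)
  \<comment> \<open>Representatives are taken in 1..d, with d in place of 0, to match the range of
    the unit classes; this matters for d = 1.\<close>
  define rep where "rep = (\<lambda>n. if d dvd n then d else n mod d)"
  have rep: "rep n \<in> {1..d}" "[n = rep n] (mod d)" for n
    using assms by (auto simp: rep_def Cong.cong_def Suc_le_eq dvd_eq_mod_eq_0 mod_less_divisor less_imp_le)
  have uniq: "[n = r] (mod d) \<longleftrightarrow> r = rep n" if "r \<in> {1..d}" for n r
  proof
    assume "[n = r] (mod d)"
    then show "r = rep n"
      using that unfolding rep_def Cong.cong_def
      by (cases "r = d") (auto simp: dvd_eq_mod_eq_0)
  qed (use rep in auto)
  have cop: "coprime (rep n) d \<longleftrightarrow> coprime n d" for n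
    using rep(2)[of n] by (metis Cong.cong_def gcd_mod_left coprime_iff_gcd_eq_1 assms gcd.commute gcd_red_nat)
  have "(\<Sum>n | n \<in> {1..?N} \<and> coprime n d. f n)
      = (\<Sum>r\<in>?U. \<Sum>n | n \<in> {n \<in> {1..?N}. coprime n d} \<and> rep n = r. f n)"
    using rep cop by (subst sum.group) auto
  also have "\<dots> = (\<Sum>r\<in>?U. \<Sum>n | n \<in> {1..?N} \<and> [n = r] (mod d). f n)"
    using uniq cop by (intro sum.cong) auto
  finally show ?thesis
    unfolding Delta_def set1 by (simp add: U[symmetric] totient_def)
qed

text \<open>Substituting b by u b turns the contribution of the frequencies with small denominators at
  the residue class of a unit u into the one at 1, up to the dilation error controlled by M.\<close>

lemma low_frequency_bound:
  fixes a :: "nat \<Rightarrow> real" and M :: real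
  assumes d: "d > 0" and u: "coprime u d" and M: "M \<ge> 0"
    and dil: "\<And>q g. q > 0 \<Longrightarrow> coprime u q \<Longrightarrow> (\<And>n. g (n + q) = g n) \<Longrightarrow> (\<And>n. norm (g n) \<le> 1) \<Longrightarrow>
      norm (\<Sum>n=1..N. of_real (a n) * (g (u * n) - g n :: complex)) \<le> M * real q"
  shows "norm ((\<Sum>b | b < d \<and> d div gcd b d \<le> K. expsum a N (real b / real d) * unity_char d (- int b * int u))
    - (\<Sum>b | b < d \<and> d div gcd b d \<le> K. expsum a N (real b / real d) * unity_char d (- int b * int 1)))
    \<le> M * real K ^ 3"
proof -
  let ?L = "{b. b < d \<and> d div gcd b d \<le> K}"
  let ?S = "\<lambda>b. expsum a N (real b / real d)"
  \<comment> \<open>The cutoff depends on b only through \<open>gcd b d\<close>, so \<phi> has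
    period d and its cutoff is unchanged under b -> u b.\<close>
  define \<phi> where "\<phi> = (\<lambda>b. if d div gcd b d \<le> K then ?S b * unity_char d (- int b) else 0)"
  have filt: "(\<Sum>b\<in>?L. F b) = (\<Sum>b<d. if d div gcd b d \<le> K then F b else 0)" for F :: "nat \<Rightarrow> complex"
    by (simp add: sum.inter_filter[symmetric] lessThan_def)
  have "?S (b + d) = ?S b" for b
    unfolding expsum_frac
    by (intro sum.cong refl arg_cong2[where f = "(*)"] unity_char_period d) (simp add: algebra_simps)
  then have per: "\<phi> (b + d) = \<phi> b" for b
    unfolding \<phi>_def using unity_char_period[OF d, of "- int (b + d)" "- int b"] by simp
  have "(\<Sum>b\<in>?L. ?S b * unity_char d (- int b * int 1)) = (\<Sum>b<d. \<phi> b)"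
    unfolding filt \<phi>_def by (intro sum.cong) auto
  also have "\<dots> = (\<Sum>b<d. \<phi> (u * b))"
    by (rule periodic_sum_unit_mult[of \<phi> d, OF per u, symmetric])
  also have "\<dots> = (\<Sum>b\<in>?L. ?S (u * b) * unity_char d (- int b * int u))"
  proof -
    have "gcd (u * b) d = gcd b d" for b
      using u by (simp add: gcd_mult_left_left_cancel coprime_commute)
    then show ?thesis unfolding filt \<phi>_def by (intro sum.cong refl) (simp add: mult.commute)
  qed
  finally have eq: "(\<Sum>b\<in>?L. ?S b * unity_char d (- int b * int u)) - (\<Sum>b\<in>?L. ?S b * unity_char d (- int b * int 1))
    = (\<Sum>b\<in>?L. (?S b - ?S (u * b)) * unity_char d (- int b * int u))"
    by (simp add: sum_subtractf algebra_simps)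
  have bound: "norm ((?S b - ?S (u * b)) * unity_char d (- int b * int u)) \<le> M * real K" if b: "b \<in> ?L" for b
  proof -
    \<comment> \<open>With q the reduced denominator of b/d, the function g below has period q.
      Moving u from the frequency to n then makes the difference of exponential sums a dilation
      error.\<close>
    define q where "q = d div gcd b d"
    define g where "g = (\<lambda>n. unity_char d (int n * int b))"
    have q: "q > 0" "q \<le> K" using b d by (auto simp: q_def div_greater_zero_iff gcd_le2_nat)
    have "q dvd d" unfolding q_def by (metis dvd_div_mult_self dvd_triv_left gcd_dvd2)
    then have uq: "coprime u q" using u by (metis coprime_divisors dvd_refl)
    have "d dvd q * b" unfolding q_def by (metis div_mult_swap dvd_div_mult_self dvd_triv_left gcd_dvd1 gcd_dvd2 mult.commute)
    then have "int d dvd int (n + q) * int b - int n * int b" for n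
      by (simp add: algebra_simps flip: of_nat_mult)
    then have "g (n + q) = g n" for n unfolding g_def by (intro unity_char_period d)
    then have "norm (\<Sum>n=1..N. of_real (a n) * (g (u * n) - g n)) \<le> M * real q"
      using q uq by (intro dil) (auto simp: g_def)
    also have "\<dots> \<le> M * real K" using q M by (intro mult_left_mono) auto
    finally have "norm (\<Sum>n=1..N. of_real (a n) * (g (u * n) - g n)) \<le> M * real K" .
    moreover have "?S (u * b) - ?S b = (\<Sum>n=1..N. of_real (a n) * (g (u * n) - g n))"
      unfolding expsum_frac g_def by (simp add: sum_subtractf algebra_simps)
    ultimately have "norm (?S (u * b) - ?S b) \<le> M * real K" by simp
    then show ?thesis by (simp add: norm_mult norm_minus_commute[of "?S b"])
  qed
  \<comment> \<open>There are at most K^2 reduced fractions with denominator at most K, each with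
    error at most M K; hence the factor K^3.\<close>
  have "card ?L \<le> card ({1..K} \<times> {..<K})"
  proof (rule card_inj_on_le[of "\<lambda>b. (d div gcd b d, b div gcd b d)"])
    show "inj_on (\<lambda>b. (d div gcd b d, b div gcd b d)) ?L"
    proof (rule inj_onI)
      fix b c assume *: "(d div gcd b d, b div gcd b d) = (d div gcd c d, c div gcd c d)"
      have "d div (d div g) = g" if "g dvd d" for g using that d by (auto elim!: dvdE)
      then have "gcd b d = gcd c d" using * by (metis gcd_dvd2 prod.inject)
      then show "b = c" using * by (metis dvd_div_mult_self gcd_dvd1 prod.inject)
    qed
    show "(\<lambda>b. (d div gcd b d, b div gcd b d)) ` ?L \<subseteq> {1..K} \<times> {..<K}"
    proof (rule image_subsetI)
      fix b assume b: "b \<in> ?L"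
      have g: "gcd b d > 0" using d by simp
      have "b div gcd b d < d div gcd b d" using b g by (intro div_less_mono) auto
      then show "(d div gcd b d, b div gcd b d) \<in> {1..K} \<times> {..<K}" using b by auto
    qed
  qed simp
  then have card: "real (card ?L) \<le> real K * real K" by (simp flip: of_nat_mult)
  have "norm (\<Sum>b\<in>?L. (?S b - ?S (u * b)) * unity_char d (- int b * int u)) \<le> (\<Sum>b\<in>?L. M * real K)"
    using bound by (rule order_trans[OF norm_sum sum_mono])
  also have "\<dots> \<le> real K * real K * (M * real K)"
    using card M by (simp add: mult_right_mono)
  finally show ?thesis unfolding eq by (simp add: power3_eq_cube mult_ac)
qed

text \<open>With \<open>lo 1 / d\<close> as centre, a class sum deviates by \<open>hi r / d\<close>,
  left to Parseval, and \<open>(lo r - lo 1) / d\<close>, a dilation error.\<close>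

lemma variance_mod_le:
  fixes a :: "nat \<Rightarrow> real" and M X :: real
  assumes d: "d > 0" and M: "M \<ge> 0" and N: "N = nat \<lfloor>X\<rfloor>"
    and dil: "\<And>q u g. q > 0 \<Longrightarrow> coprime u q \<Longrightarrow> (\<And>n. g (n + q) = g n) \<Longrightarrow> (\<And>n. norm (g n) \<le> 1) \<Longrightarrow>
      norm (\<Sum>n=1..N. of_real (a n) * (g (u * n) - g n :: complex)) \<le> M * real q"
  shows "(\<Sum>r | r \<in> {1..d} \<and> coprime r d. (Delta a X d r)\<^sup>2)
    \<le> 2 / real d * (\<Sum>q | q dvd d \<and> K < q. farey_energy a N q) + 2 * (M * real K ^ 3)\<^sup>2 / real d"
proof -
  let ?U = "{r. r \<in> {1..d} \<and> coprime r d}"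
  let ?S = "\<lambda>b. expsum a N (real b / real d)"
  define F where "F = (\<lambda>r. \<Sum>n | n \<in> {1..N} \<and> [n = r] (mod d). a n)"
  define lo where "lo = (\<lambda>r. \<Sum>b | b < d \<and> d div gcd b d \<le> K. ?S b * unity_char d (- int b * int r))"
  define hi where "hi = (\<lambda>r. \<Sum>b | b < d \<and> K < d div gcd b d. ?S b * unity_char d (- int b * int r))"
  have split: "of_real (F r) = (lo r + hi r) / of_nat d" for r
  proof -
    let ?A = "{b. b < d \<and> d div gcd b d \<le> K}" and ?B = "{b. b < d \<and> K < d div gcd b d}"
    have "(\<Sum>b<d. ?S b * unity_char d (- int b * int r)) = (\<Sum>b\<in>?A \<union> ?B. ?S b * unity_char d (- int b * int r))"
      by (rule sum.cong) auto
    also have "\<dots> = lo r + hi r"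
      unfolding lo_def hi_def by (rule sum.union_disjoint) auto
    finally show ?thesis unfolding F_def sum_residue_class_eq[OF d] by simp
  qed
  have U: "finite ?U" "?U \<noteq> {}" using d by (auto intro!: exI[of _ 1])
  have cardU: "card ?U \<le> d"
  proof -
    have "?U \<subseteq> {1..d}" by auto
    from card_mono[OF _ this] show ?thesis by simp
  qed
  have "(\<Sum>r\<in>?U. (Delta a X d r)\<^sup>2) = (\<Sum>r\<in>?U. (F r - (\<Sum>s\<in>?U. F s) / real (card ?U))\<^sup>2)"
    by (simp add: Delta_eq[OF d] F_def N)
  also have "\<dots> \<le> (\<Sum>r\<in>?U. (norm (of_real (F r) - lo 1 / of_nat d))\<^sup>2)"
    by (rule sum_variance_le[OF U])
  also have "\<dots> \<le> (\<Sum>r\<in>?U. 2 * (norm (hi r) / real d)\<^sup>2 + 2 * (M * real K ^ 3 / real d)\<^sup>2)"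
  proof (rule sum_mono)
    fix r assume r: "r \<in> ?U"
    have "of_real (F r) - lo 1 / of_nat d = hi r / of_nat d + (lo r - lo 1) / of_nat d"
      by (simp add: split add_divide_distrib diff_divide_distrib)
    then have "norm (of_real (F r) - lo 1 / of_nat d) \<le> norm (hi r) / real d + norm (lo r - lo 1) / real d"
      by (metis norm_triangle_ineq norm_divide norm_of_nat)
    also have "norm (lo r - lo 1) \<le> M * real K ^ 3"
      unfolding lo_def using r by (intro low_frequency_bound d M dil) auto
    finally have "norm (of_real (F r) - lo 1 / of_nat d) \<le> norm (hi r) / real d + M * real K ^ 3 / real d"
      by (simp add: divide_right_mono)
    then have "(norm (of_real (F r) - lo 1 / of_nat d))\<^sup>2 \<le> (norm (hi r) / real d + M * real K ^ 3 / real d)\<^sup>2"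
      by (intro power_mono) auto
    also have "\<dots> \<le> 2 * (norm (hi r) / real d)\<^sup>2 + 2 * (M * real K ^ 3 / real d)\<^sup>2"
      using sum_squares_bound[of "norm (hi r) / real d" "M * real K ^ 3 / real d"] by (simp add: power2_sum)
    finally show "(norm (of_real (F r) - lo 1 / of_nat d))\<^sup>2
      \<le> 2 * (norm (hi r) / real d)\<^sup>2 + 2 * (M * real K ^ 3 / real d)\<^sup>2" .
  qed
  also have "\<dots> = 2 / (real d)\<^sup>2 * (\<Sum>r\<in>?U. (norm (hi r))\<^sup>2) + real (card ?U) * (2 * (M * real K ^ 3 / real d)\<^sup>2)"
    by (simp add: sum.distrib sum_distrib_left power_divide)
  \<comment> \<open>By positivity the units are enlarged to all residues modulo d, where Parseval is
    exact.\<close>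
  also have "\<dots> \<le> 2 / (real d)\<^sup>2 * (\<Sum>r<d. (norm (hi r))\<^sup>2) + real d * (2 * (M * real K ^ 3 / real d)\<^sup>2)"
  proof (intro add_mono mult_left_mono mult_right_mono)
    have "(\<Sum>r\<in>?U. (norm (hi r))\<^sup>2) \<le> (\<Sum>r=1..d. (norm (hi r))\<^sup>2)"
      by (intro sum_mono2) auto
    also have "\<dots> = (\<Sum>r<d. (norm (hi r))\<^sup>2)"
    proof -
      \<comment> \<open>This passes from the residues 1..d to 0..d-1.\<close>
      have "hi d = hi 0" unfolding hi_def
        by (intro sum.cong refl arg_cong2[where f = "(*)"] unity_char_period d) auto
      then have "(\<Sum>r<Suc d. (norm (hi r))\<^sup>2) = (norm (hi d))\<^sup>2 + (\<Sum>r=1..d. (norm (hi r))\<^sup>2)"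
        by (subst sum.lessThan_Suc_shift) (simp add: sum.atLeast1_atMost_eq)
      then show ?thesis by simp
    qed
    finally show "(\<Sum>r\<in>?U. (norm (hi r))\<^sup>2) \<le> (\<Sum>r<d. (norm (hi r))\<^sup>2)" .
  qed (use cardU in auto)
  also have "(\<Sum>r<d. (norm (hi r))\<^sup>2) = real d * (\<Sum>b | b < d \<and> K < d div gcd b d. (norm (?S b))\<^sup>2)"
    unfolding hi_def by (rule parseval_mod[OF d]) auto
  also have "(\<Sum>b | b < d \<and> K < d div gcd b d. (norm (?S b))\<^sup>2) = (\<Sum>q | q dvd d \<and> K < q. farey_energy a N q)"
    unfolding farey_energy_def
    using sum_fractions_by_denominator[OF d, where f = "\<lambda>x. (norm (expsum a N x))\<^sup>2" and P = "\<lambda>q. K < q"] .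
  finally show ?thesis using d by (simp add: power2_eq_square power_divide divide_simps mult_ac)
qed

section \<open>Summation over the moduli\<close>

text \<open>Abel summation: the partial sums s of B - v are nonnegative, so lowering the weight
  attached to them can only decrease the product.\<close>

lemma sum_mult_decreasing_mono:
  fixes v B w :: "nat \<Rightarrow> real"
  assumes dom: "\<And>j. j \<le> n \<Longrightarrow> (\<Sum>q=1..j. v q) \<le> (\<Sum>q=1..j. B q)"
    and dec: "\<And>q. 1 \<le> q \<Longrightarrow> q < n \<Longrightarrow> w (Suc q) \<le> w q" and nonneg: "\<And>q. w q \<ge> 0"
  shows "(\<Sum>q=1..n. v q * w q) \<le> (\<Sum>q=1..n. B q * w q)"
proof -
  define s where "s = (\<lambda>j. \<Sum>q=1..j. B q - v q)"
  have s: "s j \<ge> 0" if "j \<le> n" for j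
    using dom[OF that] by (simp add: s_def sum_subtractf)
  have "s j * w j \<le> (\<Sum>q=1..j. (B q - v q) * w q)" if "j \<le> n" for j
    using that
  proof (induction j)
    case (Suc j)
    have "s j * w (Suc j) \<le> s j * w j"
      using Suc.prems s[of j] dec[of j] by (cases "j = 0") (auto simp: s_def intro!: mult_left_mono)
    moreover have "s (Suc j) * w (Suc j) = s j * w (Suc j) + (B (Suc j) - v (Suc j)) * w (Suc j)"
      by (simp add: s_def distrib_right)
    ultimately show ?case using Suc by simp
  qed (simp add: s_def)
  from this[of n] have "0 \<le> (\<Sum>q=1..n. (B q - v q) * w q)"
    using s[of n] nonneg[of n] by (metis mult_nonneg_nonneg order_refl order_trans)
  then show ?thesis by (simp add: sum_subtractf algebra_simps)
qed

lemma sum_inverse_squares_le: "(\<Sum>e=1..n. 1 / (real e)\<^sup>2) \<le> 2"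
proof -
  have "(\<Sum>e=1..Suc n. 1 / (real e)\<^sup>2) \<le> 2 - 1 / real (Suc n)" for n
  proof (induction n)
    case (Suc n)
    have "1 / (real (Suc (Suc n)))\<^sup>2 \<le> 1 / (real (Suc n) * real (Suc (Suc n)))"
      unfolding power2_eq_square by (intro divide_left_mono mult_right_mono) auto
    also have "\<dots> = 1 / real (Suc n) - 1 / real (Suc (Suc n))"
      by (simp add: diff_frac_eq)
    finally show ?case using Suc by simp
  qed simp
  then have "(\<Sum>e=1..Suc (n - 1). 1 / (real e)\<^sup>2) \<le> 2"
    by (rule order_trans) simp
  then show ?thesis by (cases n) auto
qed

text \<open>Writing d = q e attaches to each denominator q the decreasing weight w q. The large
  sieve controls the partial sums of the energies, and Abel summation brings in the weight.\<close>

lemma high_frequency_sum_le: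
  fixes a :: "nat \<Rightarrow> real"
  assumes N: "N > 0" and D: "D > 0" and K: "K > 0"
  defines "E \<equiv> \<Sum>n=1..N. (a n)\<^sup>2"
  shows "(\<Sum>d=1..D. 1 / real d * (\<Sum>q | q dvd d \<and> K < q. farey_energy a N q))
    \<le> 50 * E * (real N * (1 + ln (real D)) / real (K + 1) + 4 * real D)"
proof -
  define w where "w = (\<lambda>q. (\<Sum>e=1..D div q. 1 / real e) / real q)"
  define v where "v = (\<lambda>q. if K < q then farey_energy a N q else 0)"
  \<comment> \<open>Its partial sums dominate the large sieve bound N + j^2: the mass N sits at K +
    1, where v can first be nonzero, and the terms 2 q add up to j (j + 1).\<close>
  define B where "B = (\<lambda>q. 50 * E * ((if q = K + 1 then real N else 0) + 2 * real q))"
  have E: "E \<ge> 0" unfolding E_def by (intro sum_nonneg) auto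
  have w0: "w q \<ge> 0" for q unfolding w_def by (intro divide_nonneg_nonneg sum_nonneg) auto
  have "(\<Sum>d=1..D. 1 / real d * (\<Sum>q | q dvd d \<and> K < q. farey_energy a N q))
    = (\<Sum>d=1..D. \<Sum>q | q dvd d. v q / real (q * (d div q)))"
  proof (rule sum.cong[OF refl])
    fix d assume d: "d \<in> {1..D}"
    then have fin: "finite {q. q dvd d}" by auto
    have "(\<Sum>q | q dvd d \<and> K < q. farey_energy a N q) = (\<Sum>q | q dvd d. v q)"
      unfolding v_def using sum.inter_filter[OF fin, of "farey_energy a N" "\<lambda>q. K < q"] by simp
    then have "1 / real d * (\<Sum>q | q dvd d \<and> K < q. farey_energy a N q) = (\<Sum>q | q dvd d. v q / real d)"
      by (simp add: sum_divide_distrib)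
    also have "\<dots> = (\<Sum>q | q dvd d. v q / real (q * (d div q)))"
      by (intro sum.cong refl) auto
    finally show "1 / real d * (\<Sum>q | q dvd d \<and> K < q. farey_energy a N q)
      = (\<Sum>q | q dvd d. v q / real (q * (d div q)))" .
  qed
  also have "\<dots> = (\<Sum>q=1..D. \<Sum>e=1..D div q. v q / real (q * e))"
    by (rule sum_divisor_pairs)
  also have "\<dots> = (\<Sum>q=1..D. v q * w q)"
    unfolding w_def by (intro sum.cong refl) (simp add: sum_divide_distrib sum_distrib_left mult.commute)
  also have "\<dots> \<le> (\<Sum>q=1..D. B q * w q)"
  proof (rule sum_mult_decreasing_mono[OF _ _ w0])
    fix j
    show "(\<Sum>q=1..j. v q) \<le> (\<Sum>q=1..j. B q)"
    proof (cases "j \<le> K")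
      case True
      then have "(\<Sum>q=1..j. v q) = 0" by (intro sum.neutral) (auto simp: v_def)
      then show ?thesis using E by (auto simp: B_def intro!: sum_nonneg mult_nonneg_nonneg)
    next
      case False
      have "(\<Sum>q=1..j. v q) \<le> (\<Sum>q=2..j. farey_energy a N q)"
      proof -
        have "(\<Sum>q=1..j. v q) = (\<Sum>q=2..j. v q)"
          using K by (intro sum.mono_neutral_right) (auto simp: v_def)
        also have "\<dots> \<le> (\<Sum>q=2..j. farey_energy a N q)"
          by (intro sum_mono) (auto simp: v_def farey_energy_nonneg)
        finally show ?thesis .
      qed
      also have "\<dots> \<le> 50 * (real N + (real j)\<^sup>2) * E"
        unfolding E_def by (rule large_sieve_farey[OF N])
      also have "\<dots> \<le> 50 * (real N + real j * (real j + 1)) * E"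
        using E by (intro mult_right_mono) (auto simp: power2_eq_square algebra_simps)
      also have "real j * (real j + 1) = (\<Sum>q=1..j. 2 * real q)"
        by (induction j) (auto simp: algebra_simps)
      also have "50 * (real N + (\<Sum>q=1..j. 2 * real q)) * E = (\<Sum>q=1..j. B q)"
        using False unfolding B_def sum_distrib_left[symmetric] sum.distrib by simp
      finally show ?thesis .
    qed
  next
    fix q assume q: "1 \<le> q" "q < D"
    have "(\<Sum>e=1..D div Suc q. 1 / real e) \<le> (\<Sum>e=1..D div q. 1 / real e)"
      using q by (intro sum_mono2) (auto intro: order_trans[OF _ div_le_mono2])
    then show "w (Suc q) \<le> w q"
      unfolding w_def using q by (intro frac_le sum_nonneg) auto
  qed
  also have "\<dots> = 50 * E * ((\<Sum>q=1..D. if q = K + 1 then real N * w q else 0) + 2 * (\<Sum>q=1..D. real q * w q))"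
  proof -
    have "(\<Sum>q=1..D. B q * w q) = (\<Sum>q=1..D. 50 * E * ((if q = K + 1 then real N * w q else 0) + 2 * (real q * w q)))"
      unfolding B_def by (intro sum.cong refl) (auto simp: algebra_simps)
    then show ?thesis by (simp only: sum_distrib_left[symmetric] sum.distrib)
  qed
  also have "\<dots> \<le> 50 * E * (real N * (1 + ln (real D)) / real (K + 1) + 2 * (2 * real D))"
  proof (intro mult_left_mono add_mono)
    show "(\<Sum>q=1..D. if q = K + 1 then real N * w q else 0) \<le> real N * (1 + ln (real D)) / real (K + 1)"
    proof (cases "K + 1 \<le> D")
      case True
      have "D div (K + 1) > 0" "D div (K + 1) \<le> D" using True by (auto simp: div_greater_zero_iff)
      then have "(\<Sum>e=1..D div (K + 1). 1 / real e) \<le> 1 + ln (real D)"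
        by (intro order_trans[OF harm_le_ln] add_left_mono ln_mono) auto
      then have "real N * w (K + 1) \<le> real N * ((1 + ln (real D)) / real (K + 1))"
        unfolding w_def by (intro mult_left_mono divide_right_mono) auto
      then show ?thesis using True by simp
    next
      case False
      then show ?thesis using D by simp
    qed
    have "(\<Sum>q=1..D. real q * w q) = (\<Sum>q=1..D. \<Sum>e=1..D div q. 1 / real e)"
      unfolding w_def by (intro sum.cong refl) auto
    \<comment> \<open>Summing over q first yields the convergent series of 1/e^2, so D comes without
      a logarithm.\<close>
    also have "\<dots> = (\<Sum>e=1..D. \<Sum>q=1..D div e. 1 / real e)" by (rule sum_swap_div)
    also have "\<dots> \<le> (\<Sum>e=1..D. real D * (1 / (real e)\<^sup>2))"
    proof (rule sum_mono)
      fix e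
      have "real (D div e) * (1 / real e) \<le> real D / real e * (1 / real e)"
        by (intro mult_right_mono of_nat_div_le_of_nat) auto
      then show "(\<Sum>q=1..D div e. 1 / real e) \<le> real D * (1 / (real e)\<^sup>2)"
        by (simp add: power2_eq_square)
    qed
    also have "\<dots> \<le> real D * 2"
      unfolding sum_distrib_left[symmetric] by (intro mult_left_mono sum_inverse_squares_le) auto
    finally show "(\<Sum>q=1..D. real q * w q) \<le> 2 * real D" by simp
  qed (use E in auto)
  finally show ?thesis by simp
qed

section \<open>Choice of parameters and conclusion\<close>

lemma ln_power_le_powr:
  fixes \<epsilon> :: real
  assumes "\<epsilon> > 0"
  shows "\<exists>C\<ge>1. \<forall>x\<ge>1. (1 + ln x) ^ m \<le> C * x powr \<epsilon>"
proof -
  \<comment> \<open>Dividing by m + 1 instead of m keeps \<delta> positive for m = 0.\<close>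
  define \<delta> where "\<delta> = \<epsilon> / real (Suc m)"
  have \<delta>: "\<delta> > 0" using assms by (simp add: \<delta>_def)
  have "(1 + ln x) ^ m \<le> (1 + 1 / \<delta>) ^ m * x powr \<epsilon>" if x: "x \<ge> 1" for x
  proof -
    have "1 \<le> x powr \<delta>" using x \<delta> by (intro ge_one_powr_ge_zero) auto
    then have "1 + ln x \<le> (1 + 1 / \<delta>) * x powr \<delta>"
      using ln_powr_bound[OF x \<delta>] by (simp add: algebra_simps)
    then have "(1 + ln x) ^ m \<le> ((1 + 1 / \<delta>) * x powr \<delta>) ^ m"
      using x by (intro power_mono) auto
    also have "\<dots> = (1 + 1 / \<delta>) ^ m * x powr (\<delta> * real m)"
      using x by (simp add: power_mult_distrib powr_power mult.commute)
    also have "\<dots> \<le> (1 + 1 / \<delta>) ^ m * x powr \<epsilon>"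
    proof (intro mult_left_mono powr_mono)
      show "\<delta> * real m \<le> \<epsilon>" using assms by (simp add: \<delta>_def field_simps)
    qed (use x \<delta> in auto)
    finally show ?thesis .
  qed
  moreover have "(1 + 1 / \<delta>) ^ m \<ge> 1" using \<delta> by (intro one_le_power) auto
  ultimately show ?thesis by blast
qed

theorem theorem1p3:
  fixes k :: nat
  assumes "k \<ge> 4"
  shows "\<exists>C>0. \<forall>X D :: real. X \<ge> 2 \<longrightarrow> D \<ge> 1 \<longrightarrow>
    (\<Sum>d | 0 < d \<and> real d \<le> D. \<Sum>a | a \<in> {1..d} \<and> coprime a d.
        (Delta (\<lambda>n. real (tau k n)) X d a)\<^sup>2)
    \<le> C * ((D + X powr (1 - 1 / (6 * (real k + 2)))) * X * (ln X) ^ (k\<^sup>2 - 1))"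
proof -
  have k: "k > 0" "Suc (k - 1) = k" using assms by auto
  define \<delta> where "\<delta> = 1 / (6 * (real k + 2))"
  \<comment> \<open>The gap between the exponent 1/(6k) of K and the target saving \<delta>; it
    absorbs the surplus logarithms.\<close>
  define \<epsilon> where "\<epsilon> = 1 / (6 * real k) - \<delta>"
  have \<epsilon>: "\<epsilon> > 0" using k(1) by (simp add: \<epsilon>_def \<delta>_def frac_less2)
  have \<epsilon>\<delta>: "\<epsilon> - 1 / real k \<le> - \<delta>" using k by (simp add: \<epsilon>_def field_simps)
  obtain C\<^sub>0 where C\<^sub>0: "C\<^sub>0 \<ge> 1" and log: "\<And>x. x \<ge> 1 \<Longrightarrow> (1 + ln x) ^ (2 * k - 1) \<le> C\<^sub>0 * x powr \<epsilon>"
    using ln_power_le_powr[OF \<epsilon>, of "2 * k - 1"] by blast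
  obtain B where B: "B \<ge> 0" and dil: "\<And>q u Y (g :: nat \<Rightarrow> complex).
     \<lbrakk>q > 0; Y > 0; coprime u q; \<And>n. g (n + q) = g n; \<And>n. norm (g n) \<le> 1\<rbrakk> \<Longrightarrow>
     norm (\<Sum>n=1..Y. of_nat (tau k n) * (g (u * n) - g n))
       \<le> B * real q * real Y powr (1 - 1 / real k) * (1 + ln (real Y)) ^ (k - 1)"
    using tau_dilation_bound[of "k - 1"] unfolding k(2) by blast
  \<comment> \<open>For X \<ge> 2 this gives 1 + ln X \<le> c ln X.\<close>
  define c where "c = 1 + 1 / ln (2 :: real)"
  \<comment> \<open>The high frequencies contribute 100 (\<open>C\<^sub>0\<close> + 5), the low ones
    2 B^2 \<open>C\<^sub>0\<close>.\<close>
  define A where "A = 100 * C\<^sub>0 + 500 + 2 * B\<^sup>2 * C\<^sub>0"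
  have c: "c > 0" by (simp add: c_def add_pos_pos)
  have A: "A > 0" using C\<^sub>0 by (simp add: A_def add_pos_nonneg)
  show ?thesis
  proof (intro exI[of _ "A * c ^ (k\<^sup>2 - 1)"] conjI allI impI)
    show "A * c ^ (k\<^sup>2 - 1) > 0" using A c by simp
    fix X D :: real assume X: "X \<ge> 2" and D: "D \<ge> 1"
    define N D' K where "N = nat \<lfloor>X\<rfloor>" and "D' = nat \<lfloor>D\<rfloor>" and "K = nat \<lfloor>X powr (1 / (6 * real k))\<rfloor>"
    define l where "l = 1 + ln X"
    define M where "M = B * X powr (1 - 1 / real k) * l ^ (k - 1)"
    define E where "E = (\<Sum>n=1..N. (real (tau k n))\<^sup>2)"
    have N: "N > 0" "real N \<le> X" using X unfolding N_def by linarith+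
    have D': "D' > 0" "real D' \<le> D" using D unfolding D'_def by linarith+
    have P1: "X powr (1 / (6 * real k)) \<ge> 1" using X by (intro ge_one_powr_ge_zero) auto
    have K: "K > 0" "real K \<le> X powr (1 / (6 * real k))" "X powr (1 / (6 * real k)) \<le> real (K + 1)"
      using P1 unfolding K_def by linarith+
    have l: "l \<ge> 1" using X by (simp add: l_def)
    have lN: "1 + ln (real N) \<le> l" "1 + ln (real N) \<ge> 0" using N by (auto simp: l_def)
    have M: "M \<ge> 0" using B l by (simp add: M_def)
    have E: "E \<le> X * l ^ (k\<^sup>2 - 1)"
    proof -
      have "E \<le> real N * (1 + ln (real N)) ^ (k\<^sup>2 - 1)"
        unfolding E_def by (rule sum_tau_squared_le[OF k(1)])
      also have "\<dots> \<le> X * l ^ (k\<^sup>2 - 1)"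
        using N lN X by (intro mult_mono power_mono) auto
      finally show ?thesis .
    qed
    have E0: "E \<ge> 0" unfolding E_def by (intro sum_nonneg) auto
    \<comment> \<open>D may far exceed X. Bounding ln (D/X) by D/X moves the excess into the term D
      X, so no logarithm of D survives.\<close>
    have lnD: "1 + ln (real D') \<le> l + D / X" "1 + ln (real D') \<ge> 0"
    proof -
      have "ln (real D') \<le> ln D" using D' by simp
      also have "\<dots> = ln X + ln (D / X)" using X D by (simp add: ln_div)
      also have "ln (D / X) \<le> D / X" using X D by (intro ln_bound) auto
      finally show "1 + ln (real D') \<le> l + D / X" by (simp add: l_def)
      show "1 + ln (real D') \<ge> 0" using D' by simp
    qed
    have "(\<Sum>d | 0 < d \<and> real d \<le> D. \<Sum>r | r \<in> {1..d} \<and> coprime r d. (Delta (\<lambda>n. real (tau k n)) X d r)\<^sup>2)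
      = (\<Sum>d=1..D'. \<Sum>r | r \<in> {1..d} \<and> coprime r d. (Delta (\<lambda>n. real (tau k n)) X d r)\<^sup>2)"
    proof (rule sum.cong[OF _ refl])
      show "{d. 0 < d \<and> real d \<le> D} = {1..D'}"
        using D' D unfolding D'_def by (auto simp: Suc_le_eq intro: le_nat_floor) linarith
    qed
    also have "\<dots> \<le> (\<Sum>d=1..D'. 2 / real d * (\<Sum>q | q dvd d \<and> K < q. farey_energy (\<lambda>n. real (tau k n)) N q)
        + 2 * (M * real K ^ 3)\<^sup>2 / real d)"
    proof (rule sum_mono, rule variance_mod_le[OF _ M N_def])
      fix q u :: nat and g :: "nat \<Rightarrow> complex"
      assume *: "q > 0" "coprime u q" "\<And>n. g (n + q) = g n" "\<And>n. norm (g n) \<le> 1"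
      have "norm (\<Sum>n=1..N. of_nat (tau k n) * (g (u * n) - g n))
        \<le> B * real q * real N powr (1 - 1 / real k) * (1 + ln (real N)) ^ (k - 1)"
        using * N by (intro dil) auto
      also have "\<dots> \<le> B * real q * X powr (1 - 1 / real k) * l ^ (k - 1)"
        using N lN B k by (intro mult_mono power_mono powr_mono2) auto
      finally show "norm (\<Sum>n=1..N. of_real (real (tau k n)) * (g (u * n) - g n)) \<le> M * real q"
        by (simp add: M_def mult_ac)
    qed auto
    also have "\<dots> = 2 * (\<Sum>d=1..D'. 1 / real d * (\<Sum>q | q dvd d \<and> K < q. farey_energy (\<lambda>n. real (tau k n)) N q))
        + 2 * (M * real K ^ 3)\<^sup>2 * (\<Sum>d=1..D'. 1 / real d)"
      by (simp add: sum.distrib sum_distrib_left)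
    also have "\<dots> \<le> 2 * (50 * E * (real N * (1 + ln (real D')) / real (K + 1) + 4 * real D'))
        + 2 * (M * real K ^ 3)\<^sup>2 * (1 + ln (real D'))"
      unfolding E_def using high_frequency_sum_le[OF N(1) D'(1) K(1)] harm_le_ln[OF D'(1)]
      by (intro add_mono mult_left_mono) auto
    also have "\<dots> \<le> 100 * (X * l ^ (k\<^sup>2 - 1)) * (C\<^sub>0 * X powr (1 - \<delta>) + 5 * D)
        + 2 * B\<^sup>2 * C\<^sub>0 * X * (X powr (1 - \<delta>) + D)"
    proof (rule add_mono)
      have "real N * (1 + ln (real D')) / real (K + 1) \<le> X * (l + D / X) / X powr (1 / (6 * real k))"
        using N lnD K P1 X by (intro frac_le mult_mono) auto
      also have "\<dots> = l * X powr (1 - 1 / (6 * real k)) + D / X powr (1 / (6 * real k))"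
        using X by (simp add: powr_diff field_simps)
      also have "\<dots> \<le> C\<^sub>0 * X powr (1 - \<delta>) + D"
      proof (rule add_mono)
        have "l \<le> l ^ (2 * k - 1)" using l k by (intro self_le_power) auto
        also have "\<dots> \<le> C\<^sub>0 * X powr \<epsilon>" using log[of X] X by (simp add: l_def)
        finally have "l * X powr (1 - 1 / (6 * real k)) \<le> C\<^sub>0 * X powr \<epsilon> * X powr (1 - 1 / (6 * real k))"
          by (intro mult_right_mono) auto
        also have "\<dots> = C\<^sub>0 * X powr (1 - \<delta>)"
          by (simp add: mult.assoc powr_add[symmetric] \<epsilon>_def)
        finally show "l * X powr (1 - 1 / (6 * real k)) \<le> C\<^sub>0 * X powr (1 - \<delta>)" .
        show "D / X powr (1 / (6 * real k)) \<le> D" using D P1 by (simp add: divide_le_eq mult_le_cancel_left1)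
      qed
      finally have "real N * (1 + ln (real D')) / real (K + 1) + 4 * real D' \<le> C\<^sub>0 * X powr (1 - \<delta>) + 5 * D"
        using D' by simp
      then have "100 * E * (real N * (1 + ln (real D')) / real (K + 1) + 4 * real D')
        \<le> 100 * (X * l ^ (k\<^sup>2 - 1)) * (C\<^sub>0 * X powr (1 - \<delta>) + 5 * D)"
        using E E0 lnD D' by (intro mult_mono) (auto intro!: add_nonneg_nonneg order_trans[OF E0])
      then show "2 * (50 * E * (real N * (1 + ln (real D')) / real (K + 1) + 4 * real D'))
        \<le> 100 * (X * l ^ (k\<^sup>2 - 1)) * (C\<^sub>0 * X powr (1 - \<delta>) + 5 * D)" by simp
    next
      \<comment> \<open>The exponent 1/(6k) is chosen for this: the squared factor K^3 costs
        X^(1/k), half of the saving X^(2/k) contained in M^2.\<close>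
      have K6: "real K ^ 6 \<le> X powr (1 / real k)"
      proof -
        have "real K ^ 6 \<le> (X powr (1 / (6 * real k))) ^ 6" using K by (intro power_mono) auto
        also have "\<dots> = X powr (1 / real k)" using X by (simp add: powr_power)
        finally show ?thesis .
      qed
      have "2 * (M * real K ^ 3)\<^sup>2 * (1 + ln (real D')) = 2 * M\<^sup>2 * (1 + ln (real D')) * real K ^ 6"
        by (simp add: power_mult_distrib power_mult[symmetric] mult_ac)
      also have "\<dots> \<le> 2 * M\<^sup>2 * (l + D / X) * X powr (1 / real k)"
        using K6 lnD by (intro mult_mono) (auto intro: order_trans)
      also have "M\<^sup>2 = B\<^sup>2 * X powr (2 - 2 / real k) * l ^ (2 * k - 2)"
      proof -
        have "(X powr (1 - 1 / real k))\<^sup>2 = X powr (2 - 2 / real k)"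
          using X by (simp add: powr_power algebra_simps)
        moreover have "(l ^ (k - 1))\<^sup>2 = l ^ (2 * k - 2)"
        proof -
          have "(k - 1) * 2 = 2 * k - 2" by simp
          then show ?thesis by (simp only: power_mult[symmetric])
        qed
        ultimately show ?thesis by (simp add: M_def power_mult_distrib)
      qed
      also have "2 * (B\<^sup>2 * X powr (2 - 2 / real k) * l ^ (2 * k - 2)) * (l + D / X) * X powr (1 / real k)
        = 2 * B\<^sup>2 * (X powr (2 - 2 / real k) * X powr (1 / real k)) * (l ^ (2 * k - 2) * (l + D / X))"
        by (simp add: mult_ac)
      also have "X powr (2 - 2 / real k) * X powr (1 / real k) = X\<^sup>2 * X powr (- (1 / real k))"
      proof -
        have "2 - 2 / real k + 1 / real k = 2 + - (1 / real k)" using k by (simp add: field_simps)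
        then have "X powr (2 - 2 / real k) * X powr (1 / real k) = X powr 2 * X powr (- (1 / real k))"
          by (simp only: powr_add[symmetric])
        then show ?thesis using X by simp
      qed
      \<comment> \<open>All logarithms, l^(2k-2) from M^2 and one from the sum over d, are absorbed
        into X^\<epsilon>.\<close>
      also have "2 * B\<^sup>2 * (X\<^sup>2 * X powr (- (1 / real k))) * (l ^ (2 * k - 2) * (l + D / X))
        \<le> 2 * B\<^sup>2 * (X\<^sup>2 * X powr (- (1 / real k))) * (C\<^sub>0 * X powr \<epsilon> * (1 + D / X))"
      proof (rule mult_left_mono)
        have "l ^ (2 * k - 2) * (l + D / X) \<le> l ^ (2 * k - 2) * (l * (1 + D / X))"
          using l X D mult_right_mono[of 1 l "D / X"] by (intro mult_left_mono) (auto simp: algebra_simps)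
        also have "\<dots> = l ^ (2 * k - 1) * (1 + D / X)"
        proof -
          have "2 * k - 1 = Suc (2 * k - 2)" using assms by simp
          then show ?thesis by (simp only: power_Suc mult_ac)
        qed
        also have "\<dots> \<le> C\<^sub>0 * X powr \<epsilon> * (1 + D / X)"
          using log[of X] X D by (intro mult_right_mono) (auto simp: l_def)
        finally show "l ^ (2 * k - 2) * (l + D / X) \<le> C\<^sub>0 * X powr \<epsilon> * (1 + D / X)" .
      qed simp
      also have "\<dots> = 2 * B\<^sup>2 * C\<^sub>0 * X * (X powr (\<epsilon> - 1 / real k) * (X + D))"
        using X by (simp add: powr_diff powr_minus field_simps power2_eq_square)
      \<comment> \<open>The net saving 1/k - \<epsilon> is at least \<delta> for the term X, while D
        keeps only the trivial bound 1.\<close>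
      also have "\<dots> \<le> 2 * B\<^sup>2 * C\<^sub>0 * X * (X powr (1 - \<delta>) + D)"
      proof (rule mult_left_mono)
        have le: "X powr (\<epsilon> - 1 / real k) \<le> X powr (- \<delta>)" using \<epsilon>\<delta> X by (intro powr_mono) auto
        also have "X powr (- \<delta>) \<le> X powr 0" using X by (intro powr_mono) (auto simp: \<delta>_def)
        finally have "X powr (\<epsilon> - 1 / real k) \<le> 1" using X by simp
        with le have "X powr (\<epsilon> - 1 / real k) * X + X powr (\<epsilon> - 1 / real k) * D \<le> X powr (- \<delta>) * X + 1 * D"
          using X D by (intro add_mono mult_right_mono) auto
        also have "X powr (- \<delta>) * X = X powr (1 - \<delta>)" using X by (simp add: powr_diff powr_minus field_simps)
        finally show "X powr (\<epsilon> - 1 / real k) * (X + D) \<le> X powr (1 - \<delta>) + D" by (simp add: algebra_simps)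
      qed (use C\<^sub>0 X in auto)
      finally show "2 * (M * real K ^ 3)\<^sup>2 * (1 + ln (real D')) \<le> 2 * B\<^sup>2 * C\<^sub>0 * X * (X powr (1 - \<delta>) + D)" .
    qed
    \<comment> \<open>The low-frequency part carries no power of l; it is weakened by X \<le> W to
      share the common factor.\<close>
    also have "\<dots> \<le> A * ((D + X powr (1 - \<delta>)) * X * l ^ (k\<^sup>2 - 1))"
    proof -
      define Z where "Z = X powr (1 - \<delta>)"
      define W where "W = X * l ^ (k\<^sup>2 - 1)"
      have Z: "Z \<ge> 0" by (simp add: Z_def)
      have "1 \<le> l ^ (k\<^sup>2 - 1)" using l by (rule one_le_power)
      then have W: "X \<le> W" "W \<ge> 0" using X by (auto simp: W_def mult_le_cancel_left1)
      have "100 * W * (C\<^sub>0 * Z + 5 * D) \<le> 100 * W * ((C\<^sub>0 + 5) * (D + Z))"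
        using W C\<^sub>0 Z D by (intro mult_left_mono) (auto simp: algebra_simps)
      moreover have "2 * B\<^sup>2 * C\<^sub>0 * X * (Z + D) \<le> 2 * B\<^sup>2 * C\<^sub>0 * W * (Z + D)"
        using W C\<^sub>0 Z D by (intro mult_left_mono mult_right_mono) auto
      ultimately have "100 * W * (C\<^sub>0 * Z + 5 * D) + 2 * B\<^sup>2 * C\<^sub>0 * X * (Z + D) \<le> A * ((D + Z) * W)"
        by (simp add: A_def algebra_simps)
      then show ?thesis by (simp add: Z_def W_def mult_ac)
    qed
    also have "\<dots> \<le> A * ((D + X powr (1 - \<delta>)) * X * (c * ln X) ^ (k\<^sup>2 - 1))"
    proof (intro mult_left_mono power_mono)
      have "ln X / ln 2 \<ge> 1" using X by simp
      then show "l \<le> c * ln X" by (simp add: l_def c_def algebra_simps)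
    qed (use A l X D in \<open>auto intro!: mult_nonneg_nonneg add_nonneg_nonneg\<close>)
    also have "\<dots> = A * c ^ (k\<^sup>2 - 1) * ((D + X powr (1 - 1 / (6 * (real k + 2)))) * X * (ln X) ^ (k\<^sup>2 - 1))"
      by (simp add: \<delta>_def power_mult_distrib mult_ac)
    finally show "(\<Sum>d | 0 < d \<and> real d \<le> D. \<Sum>a | a \<in> {1..d} \<and> coprime a d.
        (Delta (\<lambda>n. real (tau k n)) X d a)\<^sup>2)
      \<le> A * c ^ (k\<^sup>2 - 1) * ((D + X powr (1 - 1 / (6 * (real k + 2)))) * X * (ln X) ^ (k\<^sup>2 - 1))" .
  qed
qed

end
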